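(* Let $c(n)$ be any function such that $8\le c(n)\le \frac{1+\sqrt{1+4n}}{4}$. Any $c(n)$-competitive online algorithm with advice for the maximum independent set problem with preemption requires at least \[ \frac{0.01\cdot\log_2(2c)}{2c^2}\,(n-2c) \] bits of advice on inputs of length $n$, where $c=c(n)$.
   Context: Online vertex-arrival model: an input is a graph $G$ with vertices $v_1,\dots,v_n$ presented one at a time; when $v_i$ is presented, all edges $\{v_j,v_i\}$ with $j<i$ are revealed; neither $G$ nor $n$ is known in advance. Maximum independent set with preemption: when a vertex arrives, the algorithm may accept or reject it, and may additionally preempt (discard) any previously accepted vertices; rejected or preempted vertices can never be accepted later. After each request, the current set of accepted, non-preempted vertices must be an independent set. The profit is the size of the final set; the goal is to maximize it. Advice model: the algorithm has access to an infinite binary advice string $\phi$ (chosen with knowledge of the whole input), and its decisions at step $i$ may depend on $\phi$ and the vertices seen so far. An algorithm is $c$-competitive with advice complexity $b(n)$ if for every $n$ and every input $I$ of length at most $n$ there exists $\phi$ such that its profit on $I$ with advice $\phi$ is at least $\frac{1}{c}$ times the optimal profit on $I$, and at most the first $b(n)$ bits of $\phi$ are read. *)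

theory Defs
  imports Complex_Main
begin

text \<open>An input is a finite simple graph together with the order in which its vertices are
  presented. The vertices are named \<open>0, 1, 2, \<dots>\<close> in order of arrival, and the request at position
  \<open>i\<close> is the set of all earlier vertices adjacent to \<open>i\<close>. Well-formed request lists thus correspond
  exactly to graphs with a presentation order, and the prefix of length \<open>i\<close> contains exactly what
  has been revealed about the graph after \<open>i\<close> requests.\<close>

type_synonym input = "nat set list"

definition valid_input :: "input \<Rightarrow> bool" where
  "valid_input I \<longleftrightarrow> (\<forall>i<length I. I ! i \<subseteq> {..<i})"

definition vertices :: "input \<Rightarrow> nat set" where
  "vertices I = {..<length I}"

definition edges :: "input \<Rightarrow> nat set set" where
  "edges I = {{j, i} | i j. i < length I \<and> j \<in> I ! i}"

definition independent_set :: "input \<Rightarrow> nat set \<Rightarrow> bool" where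
  "independent_set I S \<longleftrightarrow> S \<subseteq> vertices I \<and> (\<forall>e\<in>edges I. \<not> e \<subseteq> S)"

definition opt :: "input \<Rightarrow> nat" where
  "opt I = Max {card S | S. independent_set I S}"

type_synonym advice = "nat \<Rightarrow> bool"

text \<open>An algorithm maps the advice string and the nonempty list of requests seen so far to its
  decision on the latest vertex: whether to accept it, and which of the previously accepted
  vertices to preempt. Past decisions are determined by the same data, so they need not be passed
  as arguments.\<close>

type_synonym algorithm = "advice \<Rightarrow> input \<Rightarrow> bool \<times> nat set"

text \<open>The set of accepted, non-preempted vertices after the first \<open>i\<close> requests.\<close>

primrec kept :: "algorithm \<Rightarrow> advice \<Rightarrow> input \<Rightarrow> nat \<Rightarrow> nat set" where
  "kept A \<phi> I 0 = {}"
| "kept A \<phi> I (Suc i) =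
     (case A \<phi> (take (Suc i) I) of (accept, preempt) \<Rightarrow>
        (kept A \<phi> I i - preempt) \<union> (if accept then {i} else {}))"

definition profit :: "algorithm \<Rightarrow> advice \<Rightarrow> input \<Rightarrow> nat" where
  "profit A \<phi> I = card (kept A \<phi> I (length I))"

definition mis_preemption_algorithm :: "algorithm \<Rightarrow> bool" where
  "mis_preemption_algorithm A \<longleftrightarrow>
     (\<forall>\<phi> I. valid_input I \<longrightarrow> (\<forall>i\<le>length I. independent_set I (kept A \<phi> I i)))"

text \<open>On input \<open>I\<close> with advice \<open>\<phi>\<close>, at most the first \<open>b\<close> advice bits are read: no decision made
  during the run changes if the later bits are altered. An algorithm that reads advice bits one by
  one, and only while the decision is not yet determined by the bits already read, stops within the
  first \<open>b\<close> bits precisely in this case.\<close>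

definition reads_at_most :: "algorithm \<Rightarrow> advice \<Rightarrow> input \<Rightarrow> nat \<Rightarrow> bool" where
  "reads_at_most A \<phi> I b \<longleftrightarrow>
     (\<forall>\<psi>. (\<forall>k<b. \<psi> k = \<phi> k) \<longrightarrow>
        (\<forall>i<length I. A \<psi> (take (Suc i) I) = A \<phi> (take (Suc i) I)))"

definition competitive_with_advice ::
  "algorithm \<Rightarrow> (nat \<Rightarrow> real) \<Rightarrow> (nat \<Rightarrow> nat) \<Rightarrow> bool" where
  "competitive_with_advice A c b \<longleftrightarrow>
     (\<forall>n I. valid_input I \<and> length I \<le> n \<longrightarrow>
        (\<exists>\<phi>. real (profit A \<phi> I) \<ge> 1 / c n * real (opt I) \<and> reads_at_most A \<phi> I (b n)))"

end

theory Submission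
  imports Defs "HOL-Analysis.Harmonic_Numbers"
begin

text \<open>
  With \<open>b\<close> advice bits the algorithm is a family of \<open>2 ^ b\<close> deterministic strategies, and an adversary
  who knows all of them builds one input on which every strategy fails. Put \<open>L = log 2 (2 * c)\<close>.

  If \<open>n \<le> 200 * c\<^sup>2\<close>, it is enough to show \<open>b \<ge> L\<close>. Each new vertex is joined to everything that
  some strategy currently keeps. Every strategy then keeps at most one vertex, while the graph is
  \<open>2 ^ b\<close>-degenerate and so has an independent set of size \<open>n / (2 ^ b + 1)\<close>.

  If \<open>n\<close> is larger, the input is a sequence of blocks. A block is a sequence of cliques (layers) of
  \<open>s = D ^ p * q\<close> vertices, presented in \<open>p + 1\<close> phases of \<open>g\<close> layers each; at the end of the block one
  vertex per layer is declared good, and all later blocks are joined to all other vertices of this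
  block. With \<open>p = 0\<close> a strategy can only guess the good vertices, which is the usual reduction from
  string guessing; it lacks the factor \<open>L\<close> and suffices only while \<open>L\<close> is bounded. For larger \<open>L\<close>
  one takes \<open>p\<close> proportional to \<open>L\<close>. In phase \<open>k\<close> the vertices of the block are partitioned into
  \<open>D ^ k\<close> residue classes, a new vertex is joined to all earlier vertices of other classes, and after
  the phase each class is split into \<open>D\<close> parts by a cyclic shift of each layer that was not visible
  before. To accept new vertices a strategy has to commit to one class, and each split then costs it
  about all but a fraction \<open>1 / D\<close> of what it holds. So it holds \<open>O(g)\<close> vertices, while the optimum
  collects \<open>g * (p + 1)\<close> good ones.

  All shifts, and the good class, are chosen by averaging the exponential potential
  \<open>\<Sum> x ^ (number of good vertices kept)\<close> over the strategies; no randomness of the input is needed.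
\<close>

subsection \<open>Inputs and families of strategies\<close>

lemma independent_set_iff:
  assumes "valid_input I"
  shows "independent_set I S \<longleftrightarrow> S \<subseteq> {..<length I} \<and> (\<forall>u\<in>S. \<forall>v\<in>S. u \<notin> I ! v)"
proof
  assume S: "independent_set I S"
  then have sub: "S \<subseteq> {..<length I}" by (simp add: independent_set_def vertices_def)
  have "u \<notin> I ! v" if "u \<in> S" "v \<in> S" for u v
  proof
    assume "u \<in> I ! v"
    moreover have "v < length I" using sub that(2) by blast
    ultimately have "{u, v} \<in> edges I" unfolding edges_def by blast
    with S have "\<not> {u, v} \<subseteq> S" unfolding independent_set_def by (elim conjE) (rule bspec)
    with that show False by simp
  qed
  with sub show "S \<subseteq> {..<length I} \<and> (\<forall>u\<in>S. \<forall>v\<in>S. u \<notin> I ! v)" by blast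
next
  assume S: "S \<subseteq> {..<length I} \<and> (\<forall>u\<in>S. \<forall>v\<in>S. u \<notin> I ! v)"
  have "\<not> e \<subseteq> S" if "e \<in> edges I" for e
  proof -
    from that obtain i j where e: "e = {j, i}" "j \<in> I ! i"
      unfolding edges_def by (elim CollectE exE conjE)
    with S show ?thesis by blast
  qed
  with S show "independent_set I S" by (simp add: independent_set_def vertices_def)
qed

lemma card_le_opt:
  assumes "independent_set I S"
  shows "card S \<le> opt I"
proof -
  let ?C = "{card S |S. independent_set I S}"
  have "?C \<subseteq> card ` Pow {..<length I}"
    by (auto simp: independent_set_def vertices_def)
  then have "finite ?C" by (rule finite_subset) simp
  moreover have "card S \<in> ?C" using assms by blast
  ultimately show ?thesis unfolding opt_def by (rule Max_ge)
qed

lemma valid_input_append: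
  assumes "valid_input I" "\<And>i. i < length J \<Longrightarrow> J ! i \<subseteq> {..<length I + i}"
  shows "valid_input (I @ J)"
  using assms unfolding valid_input_def
  by (simp add: nth_append) (metis add_diff_inverse_nat nat_add_left_cancel_less)

lemma kept_append: "i \<le> length I \<Longrightarrow> kept A \<phi> (I @ J) i = kept A \<phi> I i"
  by (induction i) simp_all

text \<open>A step adds at most the vertex arriving then, so a vertex once lost never
  returns.\<close>

lemma kept_anti_mono:
  assumes "i \<le> j"
  shows "kept A \<phi> I j \<inter> {..<i} \<subseteq> kept A \<phi> I i"
  using assms
proof (induction j rule: dec_induct)
  case (step j)
  have "kept A \<phi> I (Suc j) \<inter> {..<i} \<subseteq> kept A \<phi> I j \<inter> {..<i}"
    using step.hyps by (simp split: prod.split) auto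
  with step.IH show ?case by blast
qed simp

lemma kept_cong:
  assumes "\<And>j. j < length I \<Longrightarrow> A \<psi> (take (Suc j) I) = A \<phi> (take (Suc j) I)" "i \<le> length I"
  shows "kept A \<psi> I i = kept A \<phi> I i"
  using assms(2) by (induction i) (simp_all add: assms(1))

section \<open>Independent sets in degenerate graphs\<close>

lemma greedy_coloring:
  assumes "valid_input I" "\<And>i. i < length I \<Longrightarrow> card (I ! i) \<le> k"
  shows "\<exists>f::nat \<Rightarrow> nat. (\<forall>i<length I. f i \<le> k \<and> (\<forall>j\<in>I ! i. f j \<noteq> f i))"
proof -
  have "\<exists>f::nat \<Rightarrow> nat. \<forall>i<m. f i \<le> k \<and> (\<forall>j\<in>I ! i. f j \<noteq> f i)" if "m \<le> length I" for m
    using that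
  proof (induction m)
    case (Suc m)
    then obtain f :: "nat \<Rightarrow> nat" where f: "\<forall>i<m. f i \<le> k \<and> (\<forall>j\<in>I ! i. f j \<noteq> f i)" by auto
    have sub: "I ! i \<subseteq> {..<i}" if "i \<le> m" for i
      using that Suc.prems assms(1) by (auto simp: valid_input_def)
    then have "finite (I ! m)" by (meson finite_lessThan finite_subset le_refl)
    then have "card (f ` (I ! m)) \<le> k"
      using assms(2)[of m] Suc.prems by (meson Suc_le_eq card_image_le le_trans)
    then have "\<not> {..k} \<subseteq> f ` (I ! m)"
      using card_mono[of "f ` (I ! m)" "{..k}"] \<open>finite (I ! m)\<close> by auto
    then obtain col where col: "col \<le> k" "col \<notin> f ` (I ! m)" by auto
    have "(f(m := col)) i \<le> k \<and> (\<forall>j\<in>I ! i. (f(m := col)) j \<noteq> (f(m := col)) i)" if "i < Suc m" for i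
    proof (cases "i = m")
      case True
      with col sub[of m] show ?thesis by fastforce
    next
      case False
      with that have "i < m" by simp
      moreover have "m \<notin> I ! i" using sub[of i] \<open>i < m\<close> by auto
      ultimately show ?thesis using f by (auto simp: fun_upd_def)
    qed
    then show ?case by blast
  qed simp
  then show ?thesis by blast
qed

text \<open>Colouring greedily in arrival order always leaves one of \<open>k + 1\<close> colours
  free; the colour classes are independent and cover the graph.\<close>

lemma length_le_opt_degenerate:
  assumes "valid_input I" "\<And>i. i < length I \<Longrightarrow> card (I ! i) \<le> k"
  shows "length I \<le> opt I * Suc k"
proof -
  obtain f :: "nat \<Rightarrow> nat" where f: "\<forall>i<length I. f i \<le> k \<and> (\<forall>j\<in>I ! i. f j \<noteq> f i)"
    using greedy_coloring[OF assms] by blast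
  let ?C = "\<lambda>a. {i. i < length I \<and> f i = a}"
  have "independent_set I (?C a)" for a
    unfolding independent_set_iff[OF assms(1)]
  proof (intro conjI ballI)
    fix u v assume "u \<in> ?C a" "v \<in> ?C a"
    moreover have "f u \<noteq> f v" if "u \<in> I ! v" "v < length I" using f that by blast
    ultimately show "u \<notin> I ! v" by force
  qed auto
  then have le: "card (?C a) \<le> opt I" for a by (rule card_le_opt)
  have "{..<length I} = (\<Union>a\<in>{..k}. ?C a)" using f by auto
  then have "length I = card (\<Union>a\<in>{..k}. ?C a)" using card_lessThan[of "length I"] by simp
  also have "\<dots> \<le> (\<Sum>a\<le>k. card (?C a))" by (rule card_UN_le) simp
  also have "\<dots> \<le> (\<Sum>a\<le>k. opt I)" by (intro sum_mono le)
  finally show ?thesis by (simp add: mult.commute)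
qed

text \<open>Abstracts deterministic strategies, \<open>K \<phi> I\<close> being what is held at the
  end of \<open>I\<close>. \<open>K_append\<close> captures both online play and irrevocability:
  continuing the input can only lose old vertices.\<close>

locale preemptive_family =
  fixes F :: "'a set" and K :: "'a \<Rightarrow> input \<Rightarrow> nat set"
  assumes finite_F: "finite F"
    and K_subset: "valid_input I \<Longrightarrow> K \<phi> I \<subseteq> {..<length I}"
    and K_independent: "valid_input I \<Longrightarrow> u \<in> K \<phi> I \<Longrightarrow> v \<in> K \<phi> I \<Longrightarrow> u \<notin> I ! v"
    and K_append: "K \<phi> (I @ J) \<inter> {..<length I} \<subseteq> K \<phi> I"
begin

lemma finite_K: "valid_input I \<Longrightarrow> finite (K \<phi> I)"
  using K_subset finite_subset by blast

text \<open>Each request is joined to all vertices currently held by some strategy, at most one per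
  strategy. Accepting it therefore means dropping the vertex held before.\<close>

lemma exists_degenerate_input:
  "\<exists>I. valid_input I \<and> length I = n \<and> (\<forall>i<n. card (I ! i) \<le> card F) \<and> (\<forall>\<phi>\<in>F. card (K \<phi> I) \<le> 1)"
proof (induction n)
  case 0
  have "K \<phi> [] = {}" for \<phi>
    using K_subset[of "[]" \<phi>] by (simp add: valid_input_def)
  then show ?case by (simp add: valid_input_def)
next
  case (Suc n)
  then obtain I where I: "valid_input I" "length I = n" "\<forall>i<n. card (I ! i) \<le> card F"
    "\<forall>\<phi>\<in>F. card (K \<phi> I) \<le> 1" by blast
  define N where "N = (\<Union>\<phi>\<in>F. K \<phi> I)"
  let ?I = "I @ [N]"
  have val: "valid_input ?I"
    using I(1) K_subset[OF I(1)] by (intro valid_input_append) (auto simp: N_def)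
  have "card N \<le> (\<Sum>\<phi>\<in>F. card (K \<phi> I))"
    unfolding N_def by (rule card_UN_le[OF finite_F])
  also have "\<dots> \<le> (\<Sum>\<phi>\<in>F. 1)" by (intro sum_mono) (use I in simp)
  finally have "card N \<le> card F" by simp
  then have "\<forall>i<Suc n. card (?I ! i) \<le> card F"
    using I(2,3) by (auto simp: nth_append less_Suc_eq)
  moreover have "card (K \<phi> ?I) \<le> 1" if "\<phi> \<in> F" for \<phi>
  proof (cases "n \<in> K \<phi> ?I")
    case True
    have "K \<phi> ?I \<subseteq> {n}"
    proof
      fix u assume u: "u \<in> K \<phi> ?I"
      then have "u < Suc n" using K_subset[OF val, of \<phi>] I(2) by auto
      moreover have "u \<notin> N" using K_independent[OF val u True] I(2) by (simp add: nth_append)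
      moreover have "u \<in> N" if "u < n"
        using K_append[of \<phi> I "[N]"] \<open>\<phi> \<in> F\<close> u I(2) that unfolding N_def by blast
      ultimately show "u \<in> {n}" by (auto simp: less_Suc_eq)
    qed
    then show ?thesis using card_mono[of "{n}" "K \<phi> ?I"] by simp
  next
    case False
    then have "K \<phi> ?I \<subseteq> {..<n}"
      using K_subset[OF val, of \<phi>] I(2) by (auto simp: less_Suc_eq)
    then have "K \<phi> ?I \<subseteq> K \<phi> I" using K_append[of \<phi> I "[N]"] I(2) by auto
    then have "card (K \<phi> ?I) \<le> card (K \<phi> I)"
      by (intro card_mono finite_K I)
    then show ?thesis using I(4) that by fastforce
  qed
  ultimately show ?case using val I(2) by (intro exI[of _ ?I] conjI) auto
qed

lemma opt_of_weak_input:
  "\<exists>I. valid_input I \<and> length I = n \<and> n \<le> opt I * Suc (card F) \<and> (\<forall>\<phi>\<in>F. card (K \<phi> I) \<le> 1)"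
  using exists_degenerate_input[of n] length_le_opt_degenerate by blast

end

subsection \<open>Averaging over the shifts\<close>

text \<open>\<open>z ^ t - 1\<close> is superadditive in \<open>t\<close>, because
  \<open>(z ^ i - 1) * (z ^ j - 1)\<close> is nonnegative.\<close>

lemma sum_power_minus_one_le:
  fixes z :: real
  assumes "finite A" "1 \<le> z"
  shows "(\<Sum>a\<in>A. z ^ f a - 1) \<le> z ^ (\<Sum>a\<in>A. f a) - 1"
  using assms(1)
proof induction
  case (insert a A)
  have "0 \<le> (z ^ f a - 1) * (z ^ sum f A - 1)"
    using assms(2) by (intro mult_nonneg_nonneg) (simp_all add: one_le_power)
  with insert show ?case by (simp add: power_add algebra_simps)
qed simp

text \<open>Independence of the coordinates of a uniform \<open>\<rho>\<close>: distinct
  \<open>v\<close> read distinct coordinates, and each coordinate that is not read contributes a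
  factor \<open>E\<close>.\<close>

lemma sum_PiE_prod:
  fixes f :: "'b \<Rightarrow> nat \<Rightarrow> real"
  assumes T: "finite T" and L: "inj_on L S" "L ` S \<subseteq> T"
  shows "(\<Sum>\<rho>\<in>PiE T (\<lambda>_. {..<E}). \<Prod>v\<in>S. f v (\<rho> (L v)))
    = real E ^ (card T - card S) * (\<Prod>v\<in>S. \<Sum>r<E. f v r)"
proof -
  define h where "h t r = (if t \<in> L ` S then f (inv_into S L t) r else 1)" for t r
  have h: "h (L v) = f v" if "v \<in> S" for v
    using that L(1) by (simp add: h_def fun_eq_iff)
  have prods: "(\<Prod>t\<in>T. g t) = (\<Prod>t\<in>T - L ` S. g t) * (\<Prod>v\<in>S. g (L v))" for g :: "_ \<Rightarrow> real"
    using T L by (simp add: prod.subset_diff[OF L(2) T] prod.reindex)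
  have "(\<Sum>\<rho>\<in>PiE T (\<lambda>_. {..<E}). \<Prod>v\<in>S. f v (\<rho> (L v)))
      = (\<Sum>\<rho>\<in>PiE T (\<lambda>_. {..<E}). \<Prod>t\<in>T. h t (\<rho> t))"
    by (intro sum.cong refl) (simp add: prods h, simp add: h_def)
  also have "\<dots> = (\<Prod>t\<in>T. \<Sum>r<E. h t r)"
    using T by (simp add: prod_sum_PiE)
  also have "\<dots> = (\<Prod>t\<in>T - L ` S. real E) * (\<Prod>v\<in>S. \<Sum>r<E. f v r)"
    by (simp add: prods h) (simp add: h_def)
  also have "card (T - L ` S) = card T - card S"
    using T L by (simp add: card_Diff_subset card_image finite_subset)
  then have "(\<Prod>t\<in>T - L ` S. real E) = real E ^ (card T - card S)" by simp
  finally show ?thesis .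
qed

text \<open>The \<open>E\<close> shifts by multiples of \<open>M\<close> carry \<open>a\<close> to
  distinct residues modulo \<open>M * E\<close>, all congruent to \<open>a\<close> modulo
  \<open>M\<close>. So \<open>u\<close> is hit at most once, and never from another class modulo
  \<open>M\<close>.\<close>

lemma shifts_hitting_residue:
  fixes a M E u :: nat and x :: real
  assumes "1 \<le> x" "0 < M" "0 < E"
  shows "(\<Sum>r<E. if (a + M * r) mod (M * E) = u then x else 1)
    \<le> (if a mod M = u mod M then E + (x - 1) else E)"
proof -
  let ?R = "{r. r < E \<and> (a + M * r) mod (M * E) = u}"
  have eq: "(\<Sum>r<E. if (a + M * r) mod (M * E) = u then x else 1) = E + (x - 1) * card ?R"
  proof -
    have "(\<Sum>r<E. if (a + M * r) mod (M * E) = u then x else 1)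
        = (\<Sum>r<E. 1 + (if (a + M * r) mod (M * E) = u then x - 1 else 0))"
      by (intro sum.cong) auto
    also have "\<dots> = E + (\<Sum>r\<in>?R. x - 1)"
      by (simp add: sum.distrib sum.If_cases lessThan_def Collect_conj_eq[symmetric])
    finally show ?thesis by simp
  qed
  have inj: "r = r'" if "r \<in> ?R" "r' \<in> ?R" "r \<le> r'" for r r'
  proof -
    have "(a + M * r') mod (M * E) = (a + M * r) mod (M * E)" using that by simp
    then have "M * E dvd (a + M * r') - (a + M * r)"
      using that(3) by (metis mod_eq_dvd_iff_nat nat_add_left_cancel_le mult_le_mono2)
    then have "M * E dvd M * (r' - r)" by (simp add: diff_mult_distrib2)
    then have "E dvd r' - r" using assms(2) by simp
    moreover have "r' < E" using that(2) by blast
    then have "r' - r < E" by linarith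
    ultimately have "r' - r = 0" using nat_dvd_not_less by blast
    with that(3) show ?thesis by simp
  qed
  have "r = r'" if "r \<in> ?R" "r' \<in> ?R" for r r'
    using inj[OF that] inj[OF that(2,1)] by linarith
  moreover have "finite ?R" by simp
  ultimately have "card ?R \<le> 1"
    unfolding One_nat_def by (subst card_le_Suc0_iff_eq) blast+
  moreover have "card ?R = 0" if "a mod M \<noteq> u mod M"
  proof -
    have "(a + M * r) mod (M * E) mod M = a mod M" for r
      by (simp add: mod_mod_cancel)
    with that have "?R = {}" by auto
    then show ?thesis by (simp only: card.empty)
  qed
  moreover have "(x - 1) * real k \<le> (if a mod M = u mod M then x - 1 else 0)"
    if "k \<le> 1" "a mod M \<noteq> u mod M \<Longrightarrow> k = 0" for k
    using that mult_left_mono[of "real k" 1 "x - 1"] assms(1) by auto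
  ultimately have "(x - 1) * real (card ?R) \<le> (if a mod M = u mod M then x - 1 else 0)"
    by blast
  then show ?thesis unfolding eq by (cases "a mod M = u mod M") simp_all
qed

text \<open>Under uniform shifts a vertex falls into a given part of its class with probability
  \<open>1 / E\<close>, independently over layers; this turns the base \<open>x\<close> into
  \<open>1 + (x - 1) / E\<close>. The old classes are then merged by superadditivity.\<close>

lemma split_average:
  fixes x :: real and c :: "nat \<Rightarrow> nat"
  assumes T: "finite T" and S: "finite S" and L: "inj_on L S" "L ` S \<subseteq> T"
    and x: "1 \<le> x" and M: "0 < M" and E: "0 < E"
  shows "(\<Sum>\<rho>\<in>PiE T (\<lambda>_. {..<E}). \<Sum>u<M * E.
      x ^ card {v\<in>S. (c v + M * \<rho> (L v)) mod (M * E) = u} - 1)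
    \<le> real E ^ card T * (E * ((1 + (x - 1) / E) ^ card S - 1))"
proof -
  let ?P = "PiE T (\<lambda>_. {..<E})"
  define z where "z = 1 + (x - 1) / E"
  have z1: "1 \<le> z" using x by (simp add: z_def)
  define l where "l w = card {v\<in>S. c v mod M = w}" for w
  have cST: "card S \<le> card T"
    using T L by (metis card_image card_mono)
  have pw: "x ^ card {v\<in>S. Q v} = (\<Prod>v\<in>S. if Q v then x else 1)" for Q
    using S by (simp add: prod.If_cases Collect_conj_eq[symmetric] Int_def)
  have one: "(\<Sum>\<rho>\<in>?P. x ^ card {v\<in>S. (c v + M * \<rho> (L v)) mod (M * E) = u})
      \<le> E ^ card T * z ^ l (u mod M)" for u
  proof -
    have "(\<Sum>\<rho>\<in>?P. x ^ card {v\<in>S. (c v + M * \<rho> (L v)) mod (M * E) = u})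
        = real E ^ (card T - card S)
          * (\<Prod>v\<in>S. \<Sum>r<E. if (c v + M * r) mod (M * E) = u then x else 1)"
      unfolding pw by (rule sum_PiE_prod[OF T L])
    also have "\<dots> \<le> real E ^ (card T - card S)
          * (\<Prod>v\<in>S. if c v mod M = u mod M then E + (x - 1) else E)"
    proof (rule mult_left_mono[OF prod_mono])
      fix v
      show "0 \<le> (\<Sum>r<E. if (c v + M * r) mod (M * E) = u then x else 1) \<and>
          (\<Sum>r<E. if (c v + M * r) mod (M * E) = u then x else 1)
          \<le> (if c v mod M = u mod M then E + (x - 1) else E)"
        using shifts_hitting_residue[OF x M E, of "c v" u] x by (auto intro!: sum_nonneg)
    qed simp
    also have "(\<Prod>v\<in>S. if c v mod M = u mod M then E + (x - 1) else E)
        = (\<Prod>v\<in>S. E * (if c v mod M = u mod M then z else 1))"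
      using E by (intro prod.cong) (auto simp: z_def field_simps)
    also have "\<dots> = real E ^ card S * z ^ l (u mod M)"
      using S by (simp add: prod.distrib l_def prod.If_cases Collect_conj_eq[symmetric] Int_def)
    also have "real E ^ (card T - card S) * (real E ^ card S * z ^ l (u mod M))
        = E ^ card T * z ^ l (u mod M)"
      using cST by (simp add: power_add[symmetric] mult.assoc[symmetric])
    finally show ?thesis .
  qed
  have cP: "card ?P = E ^ card T" using T by (simp add: card_PiE)
  have "(\<Sum>\<rho>\<in>?P. \<Sum>u<M * E. x ^ card {v\<in>S. (c v + M * \<rho> (L v)) mod (M * E) = u} - 1)
      = (\<Sum>u<M * E. (\<Sum>\<rho>\<in>?P. x ^ card {v\<in>S. (c v + M * \<rho> (L v)) mod (M * E) = u}) - E ^ card T)"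
    by (subst sum.swap) (simp add: sum_subtractf cP)
  also have "\<dots> \<le> (\<Sum>u<M * E. E ^ card T * z ^ l (u mod M) - E ^ card T)"
    by (intro sum_mono diff_right_mono one)
  \<comment> \<open>The new classes form \<open>E\<close> runs of \<open>M\<close> consecutive
    numbers, and each run meets every residue modulo \<open>M\<close> once.\<close>
  also have "\<dots> = (\<Sum>m<E. \<Sum>u\<in>{m * M..<m * M + M}. E ^ card T * z ^ l (u mod M) - E ^ card T)"
    by (simp add: sum.nat_group mult.commute)
  also have "\<dots> = (\<Sum>m<E. \<Sum>u<M. E ^ card T * z ^ l u - E ^ card T)"
  proof (rule sum.cong[OF refl])
    fix m :: nat
    show "(\<Sum>u\<in>{m * M..<m * M + M}. real (E ^ card T) * z ^ l (u mod M) - real (E ^ card T))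
        = (\<Sum>u<M. real (E ^ card T) * z ^ l u - real (E ^ card T))"
      using sum.shift_bounds_nat_ivl[of "\<lambda>u. real (E ^ card T) * z ^ l (u mod M) - real (E ^ card T)" 0 "m * M" M]
      by (simp add: atLeast0LessThan add.commute)
  qed
  also have "\<dots> = (\<Sum>m<E. E ^ card T * (\<Sum>u<M. z ^ l u - 1))"
    by (simp only: sum_distrib_left right_diff_distrib mult_1_right)
  also have "\<dots> = E ^ card T * (E * (\<Sum>u<M. z ^ l u - 1))"
    by (simp only: sum_constant card_lessThan mult.left_commute)
  also have "\<dots> \<le> E ^ card T * (E * (z ^ (\<Sum>u<M. l u) - 1))"
    by (intro mult_left_mono sum_power_minus_one_le) (use z1 in simp_all)
  also have "(\<Sum>u<M. l u) = card S"
    using sum.group[OF S finite_lessThan[of M], of "\<lambda>v. c v mod M" "\<lambda>_. 1 :: nat"] M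
    by (simp add: l_def image_subset_iff)
  finally show ?thesis by (simp add: z_def)
qed

lemma exists_le_average:
  fixes f :: "'b \<Rightarrow> real" and y :: real
  assumes "finite A" "A \<noteq> {}" "sum f A \<le> card A * y"
  shows "\<exists>a\<in>A. f a \<le> y"
proof (rule ccontr)
  assume "\<not> ?thesis"
  then have "(\<Sum>a\<in>A. y) < sum f A" using assms by (intro sum_strict_mono) auto
  with assms show False by simp
qed

text \<open>One choice has to serve all strategies: the weighted sum over \<open>F\<close> obeys the
  bound on average, hence for some \<open>\<rho>\<close>.\<close>

lemma exists_good_split:
  fixes x :: real and c :: "nat \<Rightarrow> nat" and w :: "'a \<Rightarrow> real"
  assumes F: "finite F" and w: "\<And>\<phi>. \<phi> \<in> F \<Longrightarrow> 0 \<le> w \<phi>"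
    and T: "finite T" and S: "\<And>\<phi>. \<phi> \<in> F \<Longrightarrow> finite (S \<phi>)"
    and L: "\<And>\<phi>. \<phi> \<in> F \<Longrightarrow> inj_on L (S \<phi>)" "\<And>\<phi>. \<phi> \<in> F \<Longrightarrow> L ` S \<phi> \<subseteq> T"
    and x: "1 \<le> x" and M: "0 < M" and E: "0 < E"
  shows "\<exists>\<rho>. (\<Sum>\<phi>\<in>F. w \<phi> * (\<Sum>u<M * E.
      x ^ card {v\<in>S \<phi>. (c v + M * \<rho> (L v)) mod (M * E) = u} - 1))
    \<le> (\<Sum>\<phi>\<in>F. w \<phi> * (E * ((1 + (x - 1) / E) ^ card (S \<phi>) - 1)))"
proof -
  let ?P = "PiE T (\<lambda>_. {..<E})"
  let ?f = "\<lambda>\<phi> \<rho>. \<Sum>u<M * E. x ^ card {v\<in>S \<phi>. (c v + M * \<rho> (L v)) mod (M * E) = u} - 1"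
  let ?y = "\<lambda>\<phi>. E * ((1 + (x - 1) / E) ^ card (S \<phi>) - 1)"
  have cP: "card ?P = E ^ card T" using T by (simp add: card_PiE)
  have fP: "finite ?P" using T by (simp add: finite_PiE)
  have neP: "?P \<noteq> {}" using E by (auto simp: PiE_eq_empty_iff lessThan_empty_iff)
  have "(\<Sum>\<rho>\<in>?P. \<Sum>\<phi>\<in>F. w \<phi> * ?f \<phi> \<rho>) = (\<Sum>\<phi>\<in>F. w \<phi> * (\<Sum>\<rho>\<in>?P. ?f \<phi> \<rho>))"
    by (subst sum.swap) (simp add: sum_distrib_left)
  also have "\<dots> \<le> (\<Sum>\<phi>\<in>F. w \<phi> * (real E ^ card T * ?y \<phi>))"
    by (intro sum_mono mult_left_mono split_average assms)
  also have "\<dots> = card ?P * (\<Sum>\<phi>\<in>F. w \<phi> * ?y \<phi>)"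
    by (simp add: cP sum_distrib_left algebra_simps)
  finally show ?thesis
    using exists_le_average[OF fP neP] by blast
qed

subsection \<open>The graph of a block\<close>

text \<open>Each layer is labelled cyclically with a shift of its own. Changing a shift by a
  multiple of \<open>m\<close> keeps the labels modulo \<open>m\<close>, so such a change can be
  postponed until the classes are refined.\<close>

definition residue_class :: "nat \<Rightarrow> (nat \<Rightarrow> nat) \<Rightarrow> nat \<Rightarrow> nat \<Rightarrow> nat" where
  "residue_class s sh m v = (v + sh (v div s)) mod m"

text \<open>\<open>J\<close> extends \<open>I\<close> by \<open>k\<close> layers of \<open>s\<close> vertices, the layer of \<open>v\<close> being \<open>v div s\<close>; \<open>C\<close> is the set of
  good vertices of the earlier blocks, \<open>sh\<close> the shifts of the layers so far and \<open>m\<close> the current number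
  of classes. Adjacency is only required to separate classes modulo the current \<open>m\<close>, which makes the
  condition stable under refining \<open>m\<close>.\<close>

definition block_graph ::
  "nat \<Rightarrow> input \<Rightarrow> nat set \<Rightarrow> (nat \<Rightarrow> nat) \<Rightarrow> nat \<Rightarrow> nat \<Rightarrow> input \<Rightarrow> bool" where
  "block_graph s I C sh m k J \<longleftrightarrow>
     valid_input J \<and> take (length I) J = I \<and> length J = length I + k * s \<and>
     (\<forall>v u. length I \<le> v \<longrightarrow> v < length J \<longrightarrow> u < v \<longrightarrow>
        (u < length I \<longrightarrow> (u \<in> J ! v \<longleftrightarrow> u \<notin> C)) \<and>
        (length I \<le> u \<longrightarrow> u div s = v div s \<longrightarrow> u \<in> J ! v) \<and>
        (length I \<le> u \<longrightarrow> u \<in> J ! v \<longrightarrow>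
          u div s = v div s \<or> residue_class s sh m u \<noteq> residue_class s sh m v))"

lemma block_graphD:
  assumes "block_graph s I C sh m k J"
  shows "valid_input J" "take (length I) J = I" "length J = length I + k * s"
    and "\<And>u v. length I \<le> v \<Longrightarrow> v < length J \<Longrightarrow> u < length I \<Longrightarrow> u \<in> J ! v \<longleftrightarrow> u \<notin> C"
    and "\<And>u v. length I \<le> u \<Longrightarrow> u < v \<Longrightarrow> v < length J \<Longrightarrow> u div s = v div s \<Longrightarrow> u \<in> J ! v"
    and "\<And>u v. length I \<le> u \<Longrightarrow> u < v \<Longrightarrow> v < length J \<Longrightarrow> u \<in> J ! v \<Longrightarrow>
      u div s = v div s \<or> residue_class s sh m u \<noteq> residue_class s sh m v"
proof -
  show "valid_input J" "take (length I) J = I" "length J = length I + k * s"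
    using assms by (simp_all only: block_graph_def)
  have *: "(u < length I \<longrightarrow> (u \<in> J ! v \<longleftrightarrow> u \<notin> C)) \<and>
        (length I \<le> u \<longrightarrow> u div s = v div s \<longrightarrow> u \<in> J ! v) \<and>
        (length I \<le> u \<longrightarrow> u \<in> J ! v \<longrightarrow>
          u div s = v div s \<or> residue_class s sh m u \<noteq> residue_class s sh m v)"
    if "length I \<le> v" "v < length J" "u < v" for u v
    using assms that unfolding block_graph_def by blast
  show "u \<in> J ! v \<longleftrightarrow> u \<notin> C" if "length I \<le> v" "v < length J" "u < length I" for u v
    using *[of v u] that by simp
  show "u \<in> J ! v" if "length I \<le> u" "u < v" "v < length J" "u div s = v div s" for u v
    using *[of v u] that by simp
  show "u div s = v div s \<or> residue_class s sh m u \<noteq> residue_class s sh m v"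
    if "length I \<le> u" "u < v" "v < length J" "u \<in> J ! v" for u v
    using *[of v u] that by simp
qed

text \<open>The new shifts agree with the old ones modulo \<open>m\<close>, so vertices of different
  old classes also lie in different new ones, and the graph presented so far fits both
  labellings.\<close>

lemma block_graph_refine:
  assumes "block_graph s I C sh m k J"
  shows "block_graph s I C (\<lambda>t. sh t + m * \<rho> t) (m * E) k J"
proof -
  have "residue_class s (\<lambda>t. sh t + m * \<rho> t) (m * E) v mod m = residue_class s sh m v" for v
    unfolding residue_class_def by (simp add: mod_mod_cancel add.assoc[symmetric])
  then have "residue_class s (\<lambda>t. sh t + m * \<rho> t) (m * E) u \<noteq> residue_class s (\<lambda>t. sh t + m * \<rho> t) (m * E) v"
    if "residue_class s sh m u \<noteq> residue_class s sh m v" for u v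
    using that by metis
  with assms show ?thesis unfolding block_graph_def by blast
qed

lemma block_graph_start: "valid_input I \<Longrightarrow> block_graph s I C sh m 0 I"
  unfolding block_graph_def by simp

lemma div_layer_bounds:
  fixes s :: nat
  assumes "0 < s" "s dvd l" "l \<le> v" "v < l + k * s"
  shows "v div s \<in> {l div s..<l div s + k}"
proof -
  obtain j where "l = s * j" using assms(2) by (rule dvdE)
  then have l: "l = j * s" by (simp only: mult.commute[of s j])
  have "v < j * s + k * s" using assms(4) by (simp only: l)
  then have "v < (j + k) * s" by (simp only: add_mult_distrib)
  then have "v div s < j + k" using div_less_iff_less_mult[OF assms(1)] by blast
  moreover have "l div s \<le> v div s" using assms(3) by (rule div_le_mono)
  moreover have "l div s = j" using assms(1) by (simp add: l)
  ultimately show ?thesis by simp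
qed

text \<open>Within a block all earlier vertices of other classes become neighbours, while
  \<open>block_graph\<close> keeps only the implication that survives refinement. The full adjacency
  is what forces a strategy to commit to one class.\<close>

definition phase_vertex ::
  "nat \<Rightarrow> nat \<Rightarrow> nat set \<Rightarrow> (nat \<Rightarrow> nat) \<Rightarrow> nat \<Rightarrow> nat \<Rightarrow> nat set" where
  "phase_vertex s l C sh m v = {u. u < v \<and> (if u < l then u \<notin> C
     else u div s = v div s \<or> residue_class s sh m u \<noteq> residue_class s sh m v)}"

lemma block_graph_append:
  fixes g :: nat
  assumes J: "block_graph s I C sh m k J"
  defines "J' \<equiv> J @ map (phase_vertex s (length I) C sh m) [length J..<length J + g * s]"
  shows "block_graph s I C sh m (k + g) J'"
proof -
  note D = block_graphD[OF J]
  have len: "length J' = length I + (k + g) * s"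
    by (simp add: J'_def D(3) add_mult_distrib)
  have old: "J' ! v = J ! v" if "v < length J" for v
    using that by (simp add: J'_def nth_append)
  have new: "J' ! v = phase_vertex s (length I) C sh m v" if "length J \<le> v" "v < length J'" for v
    using that by (simp add: J'_def nth_append)
  have "valid_input J'"
    unfolding J'_def using D(1)
    by (intro valid_input_append) (auto simp: phase_vertex_def)
  moreover have "take (length I) J' = I"
    using D(2,3) by (simp add: J'_def)
  moreover have "(u < length I \<longrightarrow> (u \<in> J' ! v \<longleftrightarrow> u \<notin> C)) \<and>
      (length I \<le> u \<longrightarrow> u div s = v div s \<longrightarrow> u \<in> J' ! v) \<and>
      (length I \<le> u \<longrightarrow> u \<in> J' ! v \<longrightarrow>
        u div s = v div s \<or> residue_class s sh m u \<noteq> residue_class s sh m v)"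
    if "length I \<le> v" "v < length J'" "u < v" for u v
  proof (cases "v < length J")
    case True
    with that D(4-6)[of v u] D(5,6)[of u v] D(4)[of v u] show ?thesis
      unfolding old[OF True] by blast
  next
    case False
    then show ?thesis using that by (simp add: new phase_vertex_def)
  qed
  ultimately show ?thesis unfolding block_graph_def len[symmetric] by (intro conjI allI impI refl) auto
qed

context preemptive_family
begin

lemma K_prefix:
  assumes "take (length I) J = I"
  shows "K \<phi> J \<inter> {..<length I} \<subseteq> K \<phi> I"
  using K_append[of \<phi> I "drop (length I) J"] assms by (metis append_take_drop_id)

text \<open>Each layer is a clique, so at most one of its vertices is kept.\<close>

lemma inj_on_layers:
  assumes "block_graph s I C sh m k J"
  shows "inj_on (\<lambda>v. v div s) (K \<phi> J \<inter> {length I..})"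
proof (rule linorder_inj_onI)
  fix u v assume uv: "u < v" "u \<in> K \<phi> J \<inter> {length I..}" "v \<in> K \<phi> J \<inter> {length I..}"
  have v: "v < length J" using uv(3) K_subset[OF block_graphD(1)[OF assms], of \<phi>] by auto
  have "u \<notin> J ! v" using K_independent[OF block_graphD(1)[OF assms]] uv by blast
  then show "u div s \<noteq> v div s" using block_graphD(5)[OF assms _ uv(1) v] uv(2) by auto
qed auto

lemma layers_subset:
  assumes "block_graph s I C sh m k J" "0 < s" "s dvd length I"
  shows "(\<lambda>v. v div s) ` (K \<phi> J \<inter> {length I..}) \<subseteq> {length I div s..<length I div s + k}"
proof
  fix t assume "t \<in> (\<lambda>v. v div s) ` (K \<phi> J \<inter> {length I..})"
  then obtain v where v: "t = v div s" "v \<in> K \<phi> J" "length I \<le> v" by auto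
  then have "v < length I + k * s"
    using K_subset[OF block_graphD(1)[OF assms(1)], of \<phi>] block_graphD(3)[OF assms(1)] by auto
  with v(1,3) show "t \<in> {length I div s..<length I div s + k}"
    using div_layer_bounds[OF assms(2,3)] by blast
qed

lemma card_block_le:
  assumes "block_graph s I C sh m k J" "0 < s" "s dvd length I"
  shows "card (K \<phi> J \<inter> {length I..}) \<le> k"
  using card_inj_on_le[OF inj_on_layers[OF assms(1)] layers_subset[OF assms]] by simp

text \<open>If some vertex \<open>v\<close> of the new phase is held, everything held in the block
  lies in the class of \<open>v\<close>, with at most one vertex in each of the \<open>g\<close> new
  cliques. Otherwise nothing was gained.\<close>

lemma append_phase:
  assumes J: "block_graph s I C sh m k J" and s: "0 < s" "s dvd length I" and m: "0 < m"
  obtains J' where "block_graph s I C sh m (k + g) J'"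
    and "\<And>\<phi>. card (K \<phi> J' \<inter> {length I..}) \<le> card (K \<phi> J \<inter> {length I..}) \<or>
      (\<exists>a<m. card (K \<phi> J' \<inter> {length I..})
        \<le> card {v \<in> K \<phi> J \<inter> {length I..}. residue_class s sh m v = a} + g)"
proof
  let ?l = "length I"
  let ?cls = "residue_class s sh m"
  define J' where "J' = J @ map (phase_vertex s ?l C sh m) [length J..<length J + g * s]"
  show J': "block_graph s I C sh m (k + g) J'"
    unfolding J'_def by (rule block_graph_append[OF J])
  fix \<phi>
  let ?S = "K \<phi> J \<inter> {?l..}" and ?S' = "K \<phi> J' \<inter> {?l..}"
  have lenJ: "length J = ?l + k * s" by (rule block_graphD(3)[OF J])
  have fin: "finite ?S" "finite ?S'"
    using finite_K[OF block_graphD(1)[OF J]] finite_K[OF block_graphD(1)[OF J']] by auto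
  have old: "u \<in> K \<phi> J" if "u \<in> K \<phi> J'" "u < length J" for u
    using K_append[of \<phi> J] that unfolding J'_def by blast
  show "card ?S' \<le> card ?S \<or>
      (\<exists>a<m. card ?S' \<le> card {v \<in> ?S. ?cls v = a} + g)"
  proof (cases "\<exists>v\<in>?S'. length J \<le> v")
    case False
    then have "?S' \<subseteq> ?S" using old by (auto simp: not_le)
    then show ?thesis using fin by (simp add: card_mono)
  next
    case True
    then obtain v where v: "v \<in> ?S'" "length J \<le> v" by blast
    have lt: "u < length J'" if "u \<in> K \<phi> J'" for u
      using that K_subset[OF block_graphD(1)[OF J'], of \<phi>] by auto
    have adj: "u \<in> J' ! w" if "length J \<le> w" "w < length J'" "?l \<le> u" "u < w" "?cls u \<noteq> ?cls w" for u w
      using that by (simp add: J'_def nth_append phase_vertex_def)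
    have same: "?cls u = ?cls v" if u: "u \<in> ?S'" for u
    proof (rule ccontr)
      assume ne: "?cls u \<noteq> ?cls v"
      then have "u \<noteq> v" by blast
      then have "u < v \<or> v < u" by linarith
      moreover have "?l \<le> u" "u < length J'" "?l \<le> v" "v < length J'"
        using u v(1) lt by auto
      ultimately have "u \<in> J' ! v \<or> v \<in> J' ! u"
        using adj[of v u] adj[of u v] ne v(2) by auto
      then show False
        using K_independent[OF block_graphD(1)[OF J']] u v(1) by blast
    qed
    let ?old = "{u \<in> ?S. ?cls u = ?cls v}" and ?new = "?S' \<inter> {length J..}"
    have new: "card ?new \<le> card {length J div s..<length J div s + g}"
    proof (rule card_inj_on_le)
      show "inj_on (\<lambda>v. v div s) ?new" using inj_on_layers[OF J'] by (rule inj_on_subset) auto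
      have "s dvd length J" using s(2) by (simp add: lenJ)
      moreover have "length J' = length J + g * s" by (simp add: J'_def)
      ultimately show "(\<lambda>v. v div s) ` ?new \<subseteq> {length J div s..<length J div s + g}"
        using div_layer_bounds[OF s(1), of "length J" _ g] lt by auto
    qed simp
    have "?S' \<subseteq> ?old \<union> ?new"
      using same old by (auto simp: not_le)
    moreover have "finite (?old \<union> ?new)"
      using fin finite_subset[of ?old ?S] by blast
    ultimately have "card ?S' \<le> card (?old \<union> ?new)"
      by (intro card_mono)
    then have "card ?S' \<le> card ?old + card ?new"
      using card_Un_le le_trans by blast
    moreover have "?cls v < m" using m by (simp add: residue_class_def)
    ultimately show ?thesis using new by (intro disjI2 exI[of _ "?cls v"]) simp
  qed
qed

subsection \<open>The potential within a block\<close>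

text \<open>\<open>U\<close> bounds the potential of everything held in the block; \<open>V\<close>
  bounds that of the largest class, the maximum over classes being replaced by 1 plus a sum. The two
  outcomes of a phase are simply added.\<close>

lemma append_phase_potential:
  fixes x :: real and w :: "'a \<Rightarrow> real"
  assumes J: "block_graph s I C sh m k J" and s: "0 < s" "s dvd length I" and m: "0 < m"
    and x: "1 \<le> x" and w: "\<And>\<phi>. 0 \<le> w \<phi>"
    and U: "(\<Sum>\<phi>\<in>F. w \<phi> * x ^ card (K \<phi> J \<inter> {length I..})) \<le> U"
    and V: "(\<Sum>\<phi>\<in>F. w \<phi> * (1 + (\<Sum>a<m. x ^ card {v \<in> K \<phi> J \<inter> {length I..}.
      residue_class s sh m v = a} - 1))) \<le> V"
  obtains J' where "block_graph s I C sh m (k + g) J'"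
    and "(\<Sum>\<phi>\<in>F. w \<phi> * x ^ card (K \<phi> J' \<inter> {length I..})) \<le> U + x ^ g * V"
proof -
  obtain J' where J': "block_graph s I C sh m (k + g) J'"
    and cases: "\<And>\<phi>. card (K \<phi> J' \<inter> {length I..}) \<le> card (K \<phi> J \<inter> {length I..}) \<or>
      (\<exists>a<m. card (K \<phi> J' \<inter> {length I..})
        \<le> card {v \<in> K \<phi> J \<inter> {length I..}. residue_class s sh m v = a} + g)"
    using append_phase[OF J s m] by blast
  let ?u = "\<lambda>\<phi>. x ^ card (K \<phi> J \<inter> {length I..})"
  let ?l = "\<lambda>\<phi> a. card {v \<in> K \<phi> J \<inter> {length I..}. residue_class s sh m v = a}"
  let ?v = "\<lambda>\<phi>. 1 + (\<Sum>a<m. x ^ ?l \<phi> a - 1)"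
  have nonneg: "0 \<le> x ^ i - 1" for i using x by (simp add: one_le_power)
  have v: "x ^ ?l \<phi> a \<le> ?v \<phi>" if "a < m" for \<phi> a
    using member_le_sum[of a "{..<m}" "\<lambda>a. x ^ ?l \<phi> a - 1"] nonneg that by simp
  have v0: "0 \<le> ?v \<phi>" for \<phi>
    using sum_nonneg[of "{..<m}" "\<lambda>a. x ^ ?l \<phi> a - 1"] nonneg by simp
  have xg: "0 \<le> x ^ g" using x by simp
  have one: "x ^ card (K \<phi> J' \<inter> {length I..}) \<le> ?u \<phi> + x ^ g * ?v \<phi>" for \<phi>
  proof (rule disjE[OF cases[of \<phi>]])
    assume "card (K \<phi> J' \<inter> {length I..}) \<le> card (K \<phi> J \<inter> {length I..})"
    then have "x ^ card (K \<phi> J' \<inter> {length I..}) \<le> ?u \<phi>" using x by (rule power_increasing)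
    moreover have "0 \<le> x ^ g * ?v \<phi>" by (rule mult_nonneg_nonneg[OF xg v0])
    ultimately show ?thesis by linarith
  next
    assume "\<exists>a<m. card (K \<phi> J' \<inter> {length I..}) \<le> ?l \<phi> a + g"
    then obtain a where a: "a < m" "card (K \<phi> J' \<inter> {length I..}) \<le> ?l \<phi> a + g" by blast
    have "x ^ card (K \<phi> J' \<inter> {length I..}) \<le> x ^ (?l \<phi> a + g)"
      using a(2) x by (rule power_increasing)
    also have "\<dots> = x ^ g * x ^ ?l \<phi> a" by (simp only: power_add mult.commute)
    also have "\<dots> \<le> x ^ g * ?v \<phi>" by (rule mult_left_mono[OF v[OF a(1)] xg])
    finally show ?thesis using nonneg[of "card (K \<phi> J \<inter> {length I..})"] by linarith
  qed
  have "(\<Sum>\<phi>\<in>F. w \<phi> * x ^ card (K \<phi> J' \<inter> {length I..}))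
      \<le> (\<Sum>\<phi>\<in>F. w \<phi> * (?u \<phi> + x ^ g * ?v \<phi>))"
    by (intro sum_mono mult_left_mono one w)
  also have "\<dots> = (\<Sum>\<phi>\<in>F. w \<phi> * ?u \<phi>) + x ^ g * (\<Sum>\<phi>\<in>F. w \<phi> * ?v \<phi>)"
    by (simp only: distrib_left sum.distrib sum_distrib_left mult.left_commute)
  also have "\<dots> \<le> U + x ^ g * V"
    by (intro add_mono U mult_left_mono[OF V xg])
  finally show ?thesis using that[OF J'] by blast
qed

lemma split_classes:
  fixes x :: real and w :: "'a \<Rightarrow> real"
  assumes J: "block_graph s I C sh m k J" and s: "0 < s" "s dvd length I" and m: "0 < m"
    and E: "0 < E" and x: "1 \<le> x" and w: "\<And>\<phi>. 0 \<le> w \<phi>"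
  obtains sh' where "block_graph s I C sh' (m * E) k J"
    and "(\<Sum>\<phi>\<in>F. w \<phi> * (\<Sum>a<m * E. x ^ card {v \<in> K \<phi> J \<inter> {length I..}.
        residue_class s sh' (m * E) v = a} - 1))
      \<le> (\<Sum>\<phi>\<in>F. w \<phi> * (E * ((1 + (x - 1) / E) ^ card (K \<phi> J \<inter> {length I..}) - 1)))"
proof -
  obtain \<rho> where \<rho>: "(\<Sum>\<phi>\<in>F. w \<phi> * (\<Sum>a<m * E. x ^ card {v \<in> K \<phi> J \<inter> {length I..}.
        (v + sh (v div s) + m * \<rho> (v div s)) mod (m * E) = a} - 1))
      \<le> (\<Sum>\<phi>\<in>F. w \<phi> * (E * ((1 + (x - 1) / E) ^ card (K \<phi> J \<inter> {length I..}) - 1)))"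
    using exists_good_split[where w = w and S = "\<lambda>\<phi>. K \<phi> J \<inter> {length I..}" and c = "\<lambda>v. v + sh (v div s)",
        OF finite_F w finite_atLeastLessThan _ inj_on_layers[OF J] layers_subset[OF J s] x m E]
      finite_K[OF block_graphD(1)[OF J]] by blast
  show ?thesis
  proof (rule that)
    show "block_graph s I C (\<lambda>t. sh t + m * \<rho> t) (m * E) k J"
      by (rule block_graph_refine[OF J])
  qed (use \<rho> in \<open>simp only: residue_class_def add.assoc\<close>)
qed

text \<open>\<open>AB\<close> replaces the split estimate by a linear function of
  \<open>x ^ h\<close>, so that the averages close into the recursion for \<open>y\<close>:
  \<open>y k\<close> controls all block vertices held after \<open>k\<close> phases, and
  \<open>A + B * y k\<close> the classes after the last split.\<close>

lemma block_phases:
  fixes x A B :: real and w :: "'a \<Rightarrow> real" and y :: "nat \<Rightarrow> real" and D :: nat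
  assumes I: "valid_input I" and s: "0 < s" "s dvd length I" and D: "1 \<le> D"
    and x: "1 \<le> x" and w: "\<And>\<phi>. 0 \<le> w \<phi>" and B: "0 \<le> B"
    and AB: "\<And>h. D * (1 + (x - 1) / D) ^ h \<le> A + B * x ^ h"
    and y: "y 0 = 1" "\<And>k. y (Suc k) = y k + x ^ g * (A + B * y k)"
  defines "W \<equiv> \<Sum>\<phi>\<in>F. w \<phi>"
  shows "\<exists>J sh. block_graph s I C sh (D ^ k) (k * g) J \<and>
    (\<Sum>\<phi>\<in>F. w \<phi> * x ^ card (K \<phi> J \<inter> {length I..})) \<le> y k * W \<and>
    (\<Sum>\<phi>\<in>F. w \<phi> * (1 + (\<Sum>a<D ^ k. x ^ card {v \<in> K \<phi> J \<inter> {length I..}.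
      residue_class s sh (D ^ k) v = a} - 1))) \<le> (A + B * y k) * W"
proof (induction k)
  case 0
  have W: "0 \<le> W" unfolding W_def by (intro sum_nonneg w)
  have e: "K \<phi> I \<inter> {length I..} = {}" for \<phi> using K_subset[OF I, of \<phi>] by auto
  have "1 \<le> A + B" using AB[of 0] D by simp
  then have "1 * W \<le> (A + B) * W" using W by (rule mult_right_mono)
  moreover have "block_graph s I C (\<lambda>_. 0) 1 0 I" by (rule block_graph_start[OF I])
  ultimately show ?case
    by (intro exI[of _ I] exI[of _ "\<lambda>_. 0"]) (simp add: e y(1) W_def)
next
  case (Suc k)
  then obtain J sh where J: "block_graph s I C sh (D ^ k) (k * g) J"
    and U: "(\<Sum>\<phi>\<in>F. w \<phi> * x ^ card (K \<phi> J \<inter> {length I..})) \<le> y k * W"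
    and V: "(\<Sum>\<phi>\<in>F. w \<phi> * (1 + (\<Sum>a<D ^ k. x ^ card {v \<in> K \<phi> J \<inter> {length I..}.
      residue_class s sh (D ^ k) v = a} - 1))) \<le> (A + B * y k) * W" by blast
  have Dk: "0 < D ^ k" using D by simp
  obtain J' where J': "block_graph s I C sh (D ^ k) (k * g + g) J'"
    and U': "(\<Sum>\<phi>\<in>F. w \<phi> * x ^ card (K \<phi> J' \<inter> {length I..}))
      \<le> y k * W + x ^ g * ((A + B * y k) * W)"
    using append_phase_potential[OF J s Dk x w U V] by blast
  have U'': "(\<Sum>\<phi>\<in>F. w \<phi> * x ^ card (K \<phi> J' \<inter> {length I..})) \<le> y (Suc k) * W"
    using U' by (simp only: y(2) distrib_right mult.assoc)
  have D0: "0 < D" using D by simp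
  obtain sh' where sh': "block_graph s I C sh' (D ^ k * D) (k * g + g) J'"
    and split: "(\<Sum>\<phi>\<in>F. w \<phi> * (\<Sum>a<D ^ k * D. x ^ card {v \<in> K \<phi> J' \<inter> {length I..}.
        residue_class s sh' (D ^ k * D) v = a} - 1))
      \<le> (\<Sum>\<phi>\<in>F. w \<phi> * (D * ((1 + (x - 1) / D) ^ card (K \<phi> J' \<inter> {length I..}) - 1)))"
    by (rule split_classes[OF J' s Dk D0 x w])
  have Suc_eq: "D ^ k * D = D ^ Suc k" "k * g + g = Suc k * g" by (simp_all add: mult.commute)
  have "(\<Sum>\<phi>\<in>F. w \<phi> * (1 + (\<Sum>a<D ^ Suc k. x ^ card {v \<in> K \<phi> J' \<inter> {length I..}.
        residue_class s sh' (D ^ Suc k) v = a} - 1)))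
      \<le> W + (\<Sum>\<phi>\<in>F. w \<phi> * (D * ((1 + (x - 1) / D) ^ card (K \<phi> J' \<inter> {length I..}) - 1)))"
    using split unfolding Suc_eq by (simp only: distrib_left sum.distrib W_def mult_1_right add_left_mono)
  also have "\<dots> = (\<Sum>\<phi>\<in>F. w \<phi> * (1 + D * ((1 + (x - 1) / D) ^ card (K \<phi> J' \<inter> {length I..}) - 1)))"
    by (simp only: distrib_left sum.distrib W_def mult_1_right)
  also have "\<dots> \<le> (\<Sum>\<phi>\<in>F. w \<phi> * (A + B * x ^ card (K \<phi> J' \<inter> {length I..})))"
  proof (intro sum_mono mult_left_mono w)
    fix \<phi>
    let ?h = "card (K \<phi> J' \<inter> {length I..})"
    have "1 + D * ((1 + (x - 1) / D) ^ ?h - 1) \<le> D * (1 + (x - 1) / D) ^ ?h"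
      using D by (simp add: right_diff_distrib)
    then show "1 + D * ((1 + (x - 1) / D) ^ ?h - 1) \<le> A + B * x ^ ?h"
      using AB[of ?h] by linarith
  qed
  also have "\<dots> = A * W + B * (\<Sum>\<phi>\<in>F. w \<phi> * x ^ card (K \<phi> J' \<inter> {length I..}))"
    by (simp only: distrib_left sum.distrib W_def sum_distrib_left mult.left_commute mult.commute[of A])
  also have "\<dots> \<le> A * W + B * (y (Suc k) * W)"
    by (intro add_left_mono mult_left_mono U'' B)
  finally have "(\<Sum>\<phi>\<in>F. w \<phi> * (1 + (\<Sum>a<D ^ Suc k. x ^ card {v \<in> K \<phi> J' \<inter> {length I..}.
        residue_class s sh' (D ^ Suc k) v = a} - 1))) \<le> (A + B * y (Suc k)) * W"
    by (simp only: distrib_right mult.assoc)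
  with sh' U'' show ?case unfolding Suc_eq by blast
qed

end

subsection \<open>Playing one block\<close>

lemma same_layer_eq:
  fixes u v s a :: nat
  assumes "0 < s" "u < v" "u div s = v div s"
  shows "(u + a) mod s \<noteq> (v + a) mod s"
proof
  assume "(u + a) mod s = (v + a) mod s"
  then have "s dvd (v + a) - (u + a)"
    using mod_eq_dvd_iff_nat[of "u + a" "v + a" s] assms(2) by simp
  then have "s dvd v - u" by simp
  moreover have "u div s * s = v div s * s" using assms(3) by simp
  then have "v - u = v mod s - u mod s"
    using div_mult_mod_eq[of u s] div_mult_mod_eq[of v s] by linarith
  then have "v - u < s" using mod_less_divisor[OF assms(1), of v] by linarith
  ultimately show False using nat_dvd_not_less[of "v - u" s] assms(2) by simp
qed

text \<open>With \<open>s\<close> classes on layers of \<open>s\<close> vertices, a class is a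
  transversal of the layers.\<close>

definition good_vertices :: "nat \<Rightarrow> nat \<Rightarrow> nat \<Rightarrow> (nat \<Rightarrow> nat) \<Rightarrow> nat \<Rightarrow> nat set" where
  "good_vertices s l k sh a = {v. l \<le> v \<and> v < l + k * s \<and> residue_class s sh s v = a}"

lemma card_good_vertices:
  assumes s: "0 < s" "s dvd l" and a: "a < s"
  shows "k \<le> card (good_vertices s l k sh a)"
proof -
  obtain j where "l = s * j" using s(2) by (rule dvdE)
  then have l: "l = j * s" by (simp only: mult.commute[of s j])
  \<comment> \<open>The vertex of class \<open>a\<close> in layer \<open>t\<close>;
    \<open>(s - 1) * sh t\<close> plays the role of \<open>- sh t\<close> modulo \<open>s\<close> in
    the naturals.\<close>
  define f where "f t = t * s + (a + (s - 1) * sh t) mod s" for t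
  have f_div: "f t div s = t" for t using s(1) by (simp add: f_def)
  have "f ` {j..<j + k} \<subseteq> good_vertices s l k sh a"
  proof
    fix v assume "v \<in> f ` {j..<j + k}"
    then obtain t where t: "v = f t" "j \<le> t" "t < j + k" by auto
    have "j * s \<le> t * s" using t(2) by (rule mult_le_mono1)
    then have "l \<le> v" unfolding t(1) f_def l by (rule trans_le_add1)
    have "t * s + s \<le> (j + k) * s" using t(3) mult_le_mono1[of "Suc t" "j + k" s] by simp
    moreover have "(a + (s - 1) * sh t) mod s < s" using s(1) by simp
    ultimately have "v < l + k * s" unfolding t(1) f_def l add_mult_distrib by linarith
    have "(f t + sh t) mod s = (a + (s - 1) * sh t + sh t) mod s"
      by (simp add: f_def add.assoc mod_add_left_eq)
    also have "a + (s - 1) * sh t + sh t = a + s * sh t"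
      using s(1) by (cases s) simp_all
    finally have "(f t + sh t) mod s = a" using a by simp
    then have "residue_class s sh s v = a" by (simp only: residue_class_def t(1) f_div)
    with \<open>l \<le> v\<close> \<open>v < l + k * s\<close> show "v \<in> good_vertices s l k sh a"
      by (simp add: good_vertices_def)
  qed
  moreover have "inj_on f {j..<j + k}" by (rule inj_on_inverseI[of _ "\<lambda>v. v div s"]) (rule f_div)
  moreover have "finite (good_vertices s l k sh a)" unfolding good_vertices_def by simp
  ultimately have "card {j..<j + k} \<le> card (good_vertices s l k sh a)"
    by (intro card_inj_on_le)
  then show ?thesis by simp
qed

text \<open>The block has no edges to \<open>C\<close>. Inside it an edge needs a common layer or
  different classes, and no layer contains two vertices of one class modulo
  \<open>s\<close>.\<close>

lemma independent_good_vertices: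
  fixes a :: nat
  assumes J: "block_graph s I C sh s k J" and s: "0 < s"
    and I: "valid_input I" and C: "C \<subseteq> {..<length I}" "\<forall>u\<in>C. \<forall>v\<in>C. u \<notin> I ! v"
  defines "C' \<equiv> C \<union> good_vertices s (length I) k sh a"
  shows "\<forall>u\<in>C'. \<forall>v\<in>C'. u \<notin> J ! v"
proof (intro ballI notI)
  fix u v assume u: "u \<in> C'" and v: "v \<in> C'" and uv: "u \<in> J ! v"
  note D = block_graphD[OF J]
  have v_lt: "v < length J" using v C(1) D(3) by (auto simp: C'_def good_vertices_def)
  have "u < v" using D(1) v_lt uv by (auto simp: valid_input_def)
  show False
  proof (cases "v < length I")
    case True
    then have "u \<in> C" "v \<in> C" using u v \<open>u < v\<close> by (auto simp: C'_def good_vertices_def)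
    moreover have "J ! v = I ! v" using nth_take[OF True, of J] D(2) by simp
    ultimately show False using C(2) uv by blast
  next
    case v_ge: False
    show False
    proof (cases "u < length I")
      case True
      then have "u \<in> C" using u by (auto simp: C'_def good_vertices_def)
      then show False using D(4)[OF _ v_lt True] v_ge uv by simp
    next
      case False
      then have "residue_class s sh s u = residue_class s sh s v"
        using u v v_ge C(1) by (auto simp: C'_def good_vertices_def)
      moreover from this have "u div s = v div s"
        using D(6)[OF _ \<open>u < v\<close> v_lt uv] False by simp
      ultimately show False
        using same_layer_eq[OF s \<open>u < v\<close>, of "sh (v div s)"] by (simp add: residue_class_def)
    qed
  qed
qed

context preemptive_family
begin

text \<open>Every block vertex is adjacent to all older vertices outside \<open>C\<close>, so
  holding one means having dropped all of those.\<close>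

lemma kept_old_subset:
  assumes J: "block_graph s I C sh m k J" and ne: "K \<phi> J \<inter> {length I..} \<noteq> {}"
  shows "K \<phi> J \<inter> {..<length I} \<subseteq> K \<phi> I \<inter> C"
proof
  fix u assume u: "u \<in> K \<phi> J \<inter> {..<length I}"
  from ne obtain v where v: "v \<in> K \<phi> J" "length I \<le> v" by auto
  note D = block_graphD[OF J]
  have "v < length J" using K_subset[OF D(1), of \<phi>] v(1) by auto
  then have "u \<in> C" using D(4)[OF v(2), of u] K_independent[OF D(1), of u \<phi> v] u v(1) by auto
  then show "u \<in> K \<phi> I \<inter> C" using K_prefix[OF D(2), of \<phi>] u by blast
qed

text \<open>\<open>h \<phi>\<close> is the number of vertices of the new block that \<open>\<phi>\<close> keeps. A strategy that refuses to
  drop a vertex outside \<open>C\<close> gets nothing from the block, hence the disjunctions.\<close>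

lemma play_block:
  fixes x A B :: real and y :: "nat \<Rightarrow> real" and D q s p g :: nat
  assumes I: "valid_input I" and D: "1 \<le> D" and q: "0 < q"
    and s: "s = D ^ p * q" "s dvd length I"
    and C: "C \<subseteq> {..<length I}" "\<forall>u\<in>C. \<forall>v\<in>C. u \<notin> I ! v"
    and x: "1 \<le> x" and B: "0 \<le> B"
    and AB: "\<And>h. D * (1 + (x - 1) / D) ^ h \<le> A + B * x ^ h"
    and y: "y 0 = 1" "\<And>k. y (Suc k) = y k + x ^ g * (A + B * y k)"
  defines "w \<equiv> \<lambda>\<phi>. x ^ card (K \<phi> I \<inter> C)"
  shows "\<exists>J C' h. valid_input J \<and> length J = length I + Suc p * g * s \<and> C' \<subseteq> {..<length J} \<and>
    (\<forall>u\<in>C'. \<forall>v\<in>C'. u \<notin> J ! v) \<and> card C + Suc p * g \<le> card C' \<and>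
    (\<forall>\<phi>. h \<phi> \<le> Suc p * g) \<and>
    (\<forall>\<phi>. card (K \<phi> J) \<le> card (K \<phi> I) \<or> card (K \<phi> J) \<le> card (K \<phi> I \<inter> C) + h \<phi>) \<and>
    (\<forall>\<phi>. card (K \<phi> J - C') \<le> card (K \<phi> I - C) \<or> card (K \<phi> J - C') \<le> h \<phi>) \<and>
    (\<Sum>\<phi>\<in>F. w \<phi> * x ^ h \<phi>) \<le> y (Suc p) * (\<Sum>\<phi>\<in>F. w \<phi>) \<and>
    (\<Sum>\<phi>\<in>F. x ^ card (K \<phi> J \<inter> C'))
      \<le> (\<Sum>\<phi>\<in>F. w \<phi> * (1 + ((1 + (x - 1) / q) ^ h \<phi> - 1) / D ^ p))"
proof -
  have w0: "0 \<le> w \<phi>" for \<phi> using x by (simp add: w_def)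
  have Dp: "0 < D ^ p" using D by simp
  then have s0: "0 < s" using q unfolding s(1) by (rule mult_pos_pos)
  define W where "W = (\<Sum>\<phi>\<in>F. w \<phi>)"
  \<comment> \<open>The first \<open>p\<close> phases are each followed by a \<open>D\<close>-fold
    split; one more phase, followed by a \<open>q\<close>-fold split, brings the number of classes
    to \<open>s\<close>.\<close>
  obtain J1 sh1 where J1: "block_graph s I C sh1 (D ^ p) (p * g) J1"
    and U: "(\<Sum>\<phi>\<in>F. w \<phi> * x ^ card (K \<phi> J1 \<inter> {length I..})) \<le> y p * W"
    and V: "(\<Sum>\<phi>\<in>F. w \<phi> * (1 + (\<Sum>a<D ^ p. x ^ card {v \<in> K \<phi> J1 \<inter> {length I..}.
      residue_class s sh1 (D ^ p) v = a} - 1))) \<le> (A + B * y p) * W"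
    using block_phases[where w = w and y = y, OF I s0 s(2) D x w0 B AB y] unfolding W_def by blast
  obtain J where "block_graph s I C sh1 (D ^ p) (p * g + g) J"
    and U': "(\<Sum>\<phi>\<in>F. w \<phi> * x ^ card (K \<phi> J \<inter> {length I..}))
      \<le> y p * W + x ^ g * ((A + B * y p) * W)"
    using append_phase_potential[where w = w, OF J1 s0 s(2) Dp x w0 U V] by blast
  then have J': "block_graph s I C sh1 (D ^ p) (Suc p * g) J" by (simp add: add.commute)
  define h where "h \<phi> = card (K \<phi> J \<inter> {length I..})" for \<phi>
  obtain sh where J: "block_graph s I C sh s (Suc p * g) J"
    and split: "(\<Sum>\<phi>\<in>F. w \<phi> * (\<Sum>a<s. x ^ card {v \<in> K \<phi> J \<inter> {length I..}.
        residue_class s sh s v = a} - 1))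
      \<le> (\<Sum>\<phi>\<in>F. w \<phi> * (q * ((1 + (x - 1) / q) ^ h \<phi> - 1)))"
    using split_classes[where w = w, OF J' s0 s(2) Dp q x w0] unfolding s(1)[symmetric] h_def by blast
  let ?l = "\<lambda>\<phi> a. card {v \<in> K \<phi> J \<inter> {length I..}. residue_class s sh s v = a}"
  let ?z = "\<lambda>\<phi>. (1 + (x - 1) / q) ^ h \<phi> - 1"
  \<comment> \<open>Averaging over the \<open>s\<close> candidates for the good class leaves the
    factor \<open>q / s = 1 / D ^ p\<close>.\<close>
  have "(\<Sum>a<s. \<Sum>\<phi>\<in>F. w \<phi> * (x ^ ?l \<phi> a - 1)) \<le> (\<Sum>\<phi>\<in>F. w \<phi> * (q * ?z \<phi>))"
    using split by (subst sum.swap) (simp only: sum_distrib_left)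
  also have "\<dots> = (\<Sum>\<phi>\<in>F. real s * (w \<phi> * (?z \<phi> / D ^ p)))"
    using D by (intro sum.cong refl) (simp add: s(1) field_simps)
  also have "\<dots> = card {..<s} * (\<Sum>\<phi>\<in>F. w \<phi> * (?z \<phi> / D ^ p))"
    by (simp only: sum_distrib_left card_lessThan)
  finally obtain a where a: "a < s"
    and le: "(\<Sum>\<phi>\<in>F. w \<phi> * (x ^ ?l \<phi> a - 1)) \<le> (\<Sum>\<phi>\<in>F. w \<phi> * (?z \<phi> / D ^ p))"
    using exists_le_average[of "{..<s}" "\<lambda>a. \<Sum>\<phi>\<in>F. w \<phi> * (x ^ ?l \<phi> a - 1)"] s0 by fastforce
  note gD = block_graphD[OF J]
  define G where "G = good_vertices s (length I) (Suc p * g) sh a"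
  define C' where "C' = C \<union> G"
  have finC: "finite C" using C(1) finite_subset by blast
  have finG: "finite G" unfolding G_def good_vertices_def by simp
  have finK: "finite (K \<phi> I)" "finite (K \<phi> J)" for \<phi>
    using finite_K[OF I] finite_K[OF gD(1)] by auto
  have Cle: "C' \<subseteq> {..<length J}"
    using C(1) by (auto simp: C'_def G_def good_vertices_def gD(3))
  have indep: "\<forall>u\<in>C'. \<forall>v\<in>C'. u \<notin> J ! v"
    unfolding C'_def G_def by (rule independent_good_vertices[OF J s0 I C])
  have "card C' = card C + card G"
    unfolding C'_def using finC finG C(1)
    by (intro card_Un_disjoint) (auto simp: G_def good_vertices_def)
  moreover have "Suc p * g \<le> card G"
    unfolding G_def by (rule card_good_vertices[OF s0 s(2) a])
  ultimately have card: "card C + Suc p * g \<le> card C'" by simp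
  have h: "h \<phi> \<le> Suc p * g" for \<phi>
    unfolding h_def by (rule card_block_le[OF J s0 s(2)])
  have parts: "K \<phi> J = (K \<phi> J \<inter> {..<length I}) \<union> (K \<phi> J \<inter> {length I..})" for \<phi> by auto
  have kept: "card (K \<phi> J) \<le> card (K \<phi> I) \<or> card (K \<phi> J) \<le> card (K \<phi> I \<inter> C) + h \<phi>" for \<phi>
  proof (cases "K \<phi> J \<inter> {length I..} = {}")
    case True
    then have "K \<phi> J \<subseteq> K \<phi> I" using parts[of \<phi>] K_prefix[OF gD(2), of \<phi>] by blast
    then show ?thesis using finK by (intro disjI1 card_mono)
  next
    case False
    have "card (K \<phi> J) \<le> card (K \<phi> J \<inter> {..<length I}) + h \<phi>"
      unfolding h_def using card_Un_le parts[of \<phi>] by metis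
    also have "card (K \<phi> J \<inter> {..<length I}) \<le> card (K \<phi> I \<inter> C)"
      using kept_old_subset[OF J False] finK by (intro card_mono) auto
    finally show ?thesis by simp
  qed
  have bad: "card (K \<phi> J - C') \<le> card (K \<phi> I - C) \<or> card (K \<phi> J - C') \<le> h \<phi>" for \<phi>
  proof (cases "K \<phi> J \<inter> {length I..} = {}")
    case True
    then have "K \<phi> J - C' \<subseteq> K \<phi> I - C"
      using parts[of \<phi>] K_prefix[OF gD(2), of \<phi>] by (auto simp: C'_def)
    then show ?thesis using finK by (intro disjI1 card_mono) auto
  next
    case False
    have "K \<phi> J - C' \<subseteq> K \<phi> J \<inter> {length I..}"
      using parts[of \<phi>] kept_old_subset[OF J False] by (auto simp: C'_def)
    then show ?thesis unfolding h_def using finK by (intro disjI2 card_mono) auto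
  qed
  have gain: "x ^ card (K \<phi> J \<inter> C') \<le> w \<phi> * x ^ ?l \<phi> a" for \<phi>
  proof -
    have "K \<phi> J \<inter> C' \<subseteq> (K \<phi> I \<inter> C) \<union> {v \<in> K \<phi> J \<inter> {length I..}. residue_class s sh s v = a}"
      using K_prefix[OF gD(2), of \<phi>] C(1) by (auto simp: C'_def G_def good_vertices_def)
    then have "card (K \<phi> J \<inter> C') \<le> card ((K \<phi> I \<inter> C) \<union> {v \<in> K \<phi> J \<inter> {length I..}. residue_class s sh s v = a})"
      using finK by (intro card_mono) auto
    also have "\<dots> \<le> card (K \<phi> I \<inter> C) + ?l \<phi> a" by (rule card_Un_le)
    finally have "x ^ card (K \<phi> J \<inter> C') \<le> x ^ (card (K \<phi> I \<inter> C) + ?l \<phi> a)"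
      using x by (rule power_increasing)
    then show ?thesis by (simp only: w_def power_add)
  qed
  have "(\<Sum>\<phi>\<in>F. x ^ card (K \<phi> J \<inter> C')) \<le> (\<Sum>\<phi>\<in>F. w \<phi> + w \<phi> * (x ^ ?l \<phi> a - 1))"
    using gain by (intro sum_mono) (simp add: right_diff_distrib)
  also have "\<dots> = W + (\<Sum>\<phi>\<in>F. w \<phi> * (x ^ ?l \<phi> a - 1))" by (simp only: sum.distrib W_def)
  also have "\<dots> \<le> W + (\<Sum>\<phi>\<in>F. w \<phi> * (?z \<phi> / D ^ p))" using le by simp
  also have "\<dots> = (\<Sum>\<phi>\<in>F. w \<phi> * (1 + ?z \<phi> / D ^ p))"
    by (simp only: W_def sum.distrib distrib_left mult_1_right)
  finally have good: "(\<Sum>\<phi>\<in>F. x ^ card (K \<phi> J \<inter> C')) \<le> (\<Sum>\<phi>\<in>F. w \<phi> * (1 + ?z \<phi> / D ^ p))" .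
  have pot: "(\<Sum>\<phi>\<in>F. w \<phi> * x ^ h \<phi>) \<le> y (Suc p) * (\<Sum>\<phi>\<in>F. w \<phi>)"
    using U' unfolding h_def W_def[symmetric] y(2) by (simp only: distrib_right mult.assoc)
  show ?thesis
    using gD(1,3) Cle indep card h kept bad pot good by blast
qed

subsection \<open>Sequences of blocks\<close>

text \<open>Two potentials are carried along: that of the good vertices held grows by a factor of at
  most \<open>r\<close> per block, and that of all vertices held increases by at most
  \<open>Y\<close> times the former. \<open>gain\<close> makes the yield of a block linear in
  \<open>x ^ h\<close>, so that \<open>Y\<close> bounds its average. The bad vertices held stem from
  a single block, whence the last bound.\<close>

lemma play_blocks:
  fixes x A B Y e1 e2 r :: real and y :: "nat \<Rightarrow> real" and D q s p g :: nat
  assumes D: "1 \<le> D" and q: "0 < q" and s: "s = D ^ p * q"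
    and x: "1 \<le> x" and B: "0 \<le> B"
    and AB: "\<And>h. D * (1 + (x - 1) / D) ^ h \<le> A + B * x ^ h"
    and y: "y 0 = 1" "\<And>k. y (Suc k) = y k + x ^ g * (A + B * y k)"
    and Y: "y (Suc p) \<le> Y" "0 \<le> Y" and e: "0 \<le> e1" "0 \<le> e2"
    and gain: "\<And>h. h \<le> Suc p * g \<Longrightarrow> ((1 + (x - 1) / q) ^ h - 1) / D ^ p \<le> e1 + e2 * x ^ h"
  defines "r \<equiv> 1 + (e1 + e2 * Y)"
  shows "\<exists>I C. valid_input I \<and> length I = m * (Suc p * g * s) \<and> C \<subseteq> {..<length I} \<and>
    (\<forall>u\<in>C. \<forall>v\<in>C. u \<notin> I ! v) \<and> m * (Suc p * g) \<le> card C \<and>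
    (\<Sum>\<phi>\<in>F. x ^ card (K \<phi> I \<inter> C)) \<le> card F * r ^ m \<and>
    (\<Sum>\<phi>\<in>F. x ^ card (K \<phi> I)) \<le> card F * (1 + Y * (\<Sum>i<m. r ^ i)) \<and>
    (\<forall>\<phi>. card (K \<phi> I - C) \<le> Suc p * g)"
proof (induction m)
  case 0
  have "valid_input []" by (simp add: valid_input_def)
  moreover have "K \<phi> [] = {}" for \<phi> using K_subset[OF \<open>valid_input []\<close>, of \<phi>] by simp
  ultimately show ?case by (intro exI[of _ "[]"] exI[of _ "{}"]) simp
next
  case (Suc m)
  then obtain I C where I: "valid_input I" "length I = m * (Suc p * g * s)"
    and C: "C \<subseteq> {..<length I}" "\<forall>u\<in>C. \<forall>v\<in>C. u \<notin> I ! v" "m * (Suc p * g) \<le> card C"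
    and good: "(\<Sum>\<phi>\<in>F. x ^ card (K \<phi> I \<inter> C)) \<le> card F * r ^ m"
    and all: "(\<Sum>\<phi>\<in>F. x ^ card (K \<phi> I)) \<le> card F * (1 + Y * (\<Sum>i<m. r ^ i))"
    and bad: "\<forall>\<phi>. card (K \<phi> I - C) \<le> Suc p * g" by blast
  have "s dvd length I" by (simp add: I(2))
  from play_block[where A = A and B = B and y = y and g = g, OF I(1) D q s this C(1,2) x B AB y]
  obtain J C' h where J: "valid_input J" "length J = length I + Suc p * g * s" "C' \<subseteq> {..<length J}"
      "\<forall>u\<in>C'. \<forall>v\<in>C'. u \<notin> J ! v" "card C + Suc p * g \<le> card C'"
    and h: "\<forall>\<phi>. h \<phi> \<le> Suc p * g"
    and kept: "\<forall>\<phi>. card (K \<phi> J) \<le> card (K \<phi> I) \<or> card (K \<phi> J) \<le> card (K \<phi> I \<inter> C) + h \<phi>"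
    and bad': "\<forall>\<phi>. card (K \<phi> J - C') \<le> card (K \<phi> I - C) \<or> card (K \<phi> J - C') \<le> h \<phi>"
    and pot: "(\<Sum>\<phi>\<in>F. x ^ card (K \<phi> I \<inter> C) * x ^ h \<phi>)
        \<le> y (Suc p) * (\<Sum>\<phi>\<in>F. x ^ card (K \<phi> I \<inter> C))"
    and good': "(\<Sum>\<phi>\<in>F. x ^ card (K \<phi> J \<inter> C'))
      \<le> (\<Sum>\<phi>\<in>F. x ^ card (K \<phi> I \<inter> C) * (1 + ((1 + (x - 1) / q) ^ h \<phi> - 1) / D ^ p))"
    by blast
  define W where "W = (\<Sum>\<phi>\<in>F. x ^ card (K \<phi> I \<inter> C))"
  have xp: "0 \<le> x ^ i" for i using x by simp
  have W: "0 \<le> W" unfolding W_def by (intro sum_nonneg xp)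
  have r0: "0 \<le> r" using Y e by (simp add: r_def)
  have pot': "(\<Sum>\<phi>\<in>F. x ^ card (K \<phi> I \<inter> C) * x ^ h \<phi>) \<le> Y * W"
    using pot mult_right_mono[OF Y(1) W] unfolding W_def by linarith
  have "(\<Sum>\<phi>\<in>F. x ^ card (K \<phi> J \<inter> C'))
      \<le> (\<Sum>\<phi>\<in>F. x ^ card (K \<phi> I \<inter> C) * (1 + (e1 + e2 * x ^ h \<phi>)))"
    by (rule order_trans[OF good']) (intro sum_mono mult_left_mono add_left_mono gain xp h[rule_format])
  also have "\<dots> = (1 + e1) * W + e2 * (\<Sum>\<phi>\<in>F. x ^ card (K \<phi> I \<inter> C) * x ^ h \<phi>)"
    by (simp add: W_def sum_distrib_left sum.distrib[symmetric] algebra_simps)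
  also have "\<dots> \<le> (1 + e1) * W + e2 * (Y * W)"
    by (intro add_left_mono mult_left_mono pot' e)
  also have "\<dots> = r * W" by (simp add: r_def algebra_simps)
  also have "\<dots> \<le> r * (card F * r ^ m)"
    using good r0 unfolding W_def by (rule mult_left_mono)
  finally have 1: "(\<Sum>\<phi>\<in>F. x ^ card (K \<phi> J \<inter> C')) \<le> card F * r ^ Suc m" by (simp add: ac_simps)
  have one: "x ^ card (K \<phi> J) \<le> x ^ card (K \<phi> I) + x ^ card (K \<phi> I \<inter> C) * x ^ h \<phi>" for \<phi>
  proof (rule disjE[OF kept[rule_format, of \<phi>]])
    assume "card (K \<phi> J) \<le> card (K \<phi> I)"
    then have "x ^ card (K \<phi> J) \<le> x ^ card (K \<phi> I)" using x by (rule power_increasing)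
    moreover have "0 \<le> x ^ card (K \<phi> I \<inter> C) * x ^ h \<phi>" using xp by (intro mult_nonneg_nonneg)
    ultimately show ?thesis by linarith
  next
    assume "card (K \<phi> J) \<le> card (K \<phi> I \<inter> C) + h \<phi>"
    then have "x ^ card (K \<phi> J) \<le> x ^ (card (K \<phi> I \<inter> C) + h \<phi>)" using x by (rule power_increasing)
    then show ?thesis using xp[of "card (K \<phi> I)"] unfolding power_add by linarith
  qed
  have "(\<Sum>\<phi>\<in>F. x ^ card (K \<phi> J))
      \<le> (\<Sum>\<phi>\<in>F. x ^ card (K \<phi> I) + x ^ card (K \<phi> I \<inter> C) * x ^ h \<phi>)"
    by (intro sum_mono one)
  also have "\<dots> \<le> card F * (1 + Y * (\<Sum>i<m. r ^ i)) + Y * (card F * r ^ m)"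
  proof -
    have "Y * W \<le> Y * (card F * r ^ m)" unfolding W_def by (rule mult_left_mono[OF good Y(2)])
    then show ?thesis using all pot' unfolding sum.distrib by linarith
  qed
  also have "\<dots> = card F * (1 + Y * (\<Sum>i<Suc m. r ^ i))" by (simp add: algebra_simps)
  finally have 2: "(\<Sum>\<phi>\<in>F. x ^ card (K \<phi> J)) \<le> card F * (1 + Y * (\<Sum>i<Suc m. r ^ i))" .
  have 3: "\<forall>\<phi>. card (K \<phi> J - C') \<le> Suc p * g" using bad bad' h le_trans by blast
  have 4: "length J = Suc m * (Suc p * g * s)" by (simp only: J(2) I(2) mult_Suc add.commute)
  have 5: "Suc m * (Suc p * g) \<le> card C'" using J(5) C(3) by simp
  show ?case using J(1,3,4) 1 2 3 4 5 by blast
qed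

end

lemma log2_add_one_le:
  fixes t :: real
  assumes "0 \<le> t"
  shows "log 2 (1 + t) \<le> 3 / 2 * t"
proof -
  have "2/3 \<le> ln (2::real)" by (rule ln2_ge_two_thirds)
  then have "3 / 2 * t * ln 2 \<ge> t" using assms mult_left_mono[of "2/3" "ln 2" "3/2 * t"] by simp
  then have "ln (1 + t) \<le> 3 / 2 * t * ln 2" using ln_add_one_self_le_self[OF assms] by linarith
  then show ?thesis by (simp add: log_def field_simps)
qed

subsection \<open>Numerical estimates\<close>

lemma member_power_le_sum:
  fixes x :: real
  assumes "finite F" "\<phi> \<in> F" "0 < x"
  shows "x ^ f \<phi> \<le> (\<Sum>\<phi>\<in>F. x ^ f \<phi>)"
  using member_le_sum[of \<phi> F "\<lambda>\<phi>. x ^ f \<phi>"] assms by simp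

lemma log2_5_ge: "23 / 10 \<le> log 2 (5::real)"
proof -
  have "log 2 (2 ^ 23) \<le> log 2 ((5::real) ^ 10)" by simp
  then show ?thesis by (simp only: log_nat_power zero_less_numeral) simp
qed

text \<open>Absorbs the polynomial factor in \<open>phase_recursion_bound\<close> into a power of
  two.\<close>

lemma last_phase_growth:
  fixes P :: nat
  assumes "14 \<le> P"
  shows "13 * P \<le> 2 ^ (P div 2 + 1)"
proof -
  have "13 * (2 * k + 1) \<le> (2::nat) ^ (k + 1)" if "7 \<le> k" for k
    using that by (induction k rule: nat_induct_at_least) simp_all
  from this[of "P div 2"] have "13 * (2 * (P div 2) + 1) \<le> 2 ^ (P div 2 + 1)" using assms by simp
  moreover have "13 * P \<le> 13 * (2 * (P div 2) + 1)" by (intro mult_le_mono2) simp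
  ultimately show ?thesis by (rule order_trans[rotated])
qed

text \<open>Together with \<open>8 ^ p < 2 * c\<close> and \<open>p = P - 1\<close> this will give
  \<open>P ^ 3 * 4 ^ p \<le> 17 / 20 * c\<close>.\<close>

lemma cube_le_power:
  fixes P :: nat
  assumes "14 \<le> P"
  shows "40 * P ^ 3 \<le> 17 * 2 ^ (P - 1)"
  using assms
proof (induction P rule: nat_induct_at_least)
  case (Suc P)
  have "Suc P ^ 3 \<le> 2 * P ^ 3"
  proof -
    have "3 * P * P + 3 * P + 1 \<le> P * P * P"
    proof -
      have "3 * P + 1 \<le> P * P" using Suc.hyps mult_le_mono1[OF Suc.hyps, of P] by linarith
      then have "3 * P * P + 3 * P + 1 \<le> 4 * (P * P)" by simp
      also have "\<dots> \<le> P * (P * P)" using Suc.hyps by (intro mult_le_mono1) simp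
      finally show ?thesis by (simp only: mult.assoc)
    qed
    then show ?thesis by (simp add: power3_eq_cube algebra_simps)
  qed
  moreover have "(2::nat) ^ (Suc P - 1) = 2 * 2 ^ (P - 1)" using Suc.hyps by (cases P) simp_all
  ultimately show ?case using Suc.IH by simp
qed simp

text \<open>Interpolates between the two regimes \<open>h \<le> 3 g\<close> and \<open>h \<ge> 3 g\<close>; the resulting linear bound
  is what lets the averaged potential be propagated.\<close>

lemma five_quarters_power_le:
  fixes g h :: nat
  shows "(5 / 4 :: real) ^ h \<le> (5 / 4) ^ (3 * g) + (5 / 8) ^ (3 * g) * 2 ^ h"
proof (cases "h \<le> 3 * g")
  case True
  then have "(5 / 4 :: real) ^ h \<le> (5 / 4) ^ (3 * g)" by (intro power_increasing) simp_all
  then show ?thesis by (simp add: add_increasing2)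
next
  case False
  then have "(5 / 8 :: real) ^ h \<le> (5 / 8) ^ (3 * g)" by (intro power_decreasing) simp_all
  then have "(5 / 8) ^ h * 2 ^ h \<le> (5 / 8 :: real) ^ (3 * g) * 2 ^ h" by (rule mult_right_mono) simp
  then show ?thesis by (simp add: power_mult_distrib[symmetric] add_increasing)
qed

text \<open>The recursion of \<open>block_phases\<close> for \<open>x = 2\<close>,
  \<open>D = 4\<close>, \<open>g = P\<close>. A phase adds at most \<open>X = 4 ^ (P + 1)\<close>
  and multiplies by at most \<open>t = 1 + 1 / P\<close>; over \<open>P\<close> phases the factors
  compound to at most \<open>exp 1 \<le> 3\<close>.\<close>

lemma phase_recursion_bound:
  fixes P :: nat and y :: "nat \<Rightarrow> real"
  assumes P: "14 \<le> P"
    and y: "y 0 = 1"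
      "\<And>k. y (Suc k) = y k + 2 ^ P * (4 * (5 / 4) ^ (3 * P) + 4 * (5 / 8) ^ (3 * P) * y k)"
  shows "y P \<le> 2 ^ (2 * P + P div 2 + 1)"
proof -
  define t where "t = 1 + 1 / real P"
  define X where "X = (4::real) ^ (P + 1)"
  have t1: "1 \<le> t" by (simp add: t_def)
  have X: "2 ^ P * (4 * (5 / 4) ^ (3 * P)) \<le> X"
  proof -
    have "2 ^ P * (4 * (5 / 4) ^ (3 * P)) = 4 * (125 / 32 :: real) ^ P"
      by (simp add: power_mult power_mult_distrib[symmetric] mult.left_commute[of _ 4] power3_eq_cube)
    also have "\<dots> \<le> 4 * 4 ^ P" by (intro mult_left_mono power_mono) simp_all
    finally show ?thesis by (simp add: X_def)
  qed
  have T: "2 ^ P * (4 * (5 / 8) ^ (3 * P)) \<le> 1 / real P"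
  proof -
    have "2 ^ P * (4 * (5 / 8) ^ (3 * P)) = 4 * (125 / 256 :: real) ^ P"
      by (simp add: power_mult power_mult_distrib[symmetric] mult.left_commute[of _ 4] power3_eq_cube)
    also have "\<dots> \<le> 4 * (1 / 2) ^ P" by (intro mult_left_mono power_mono) simp_all
    also have "\<dots> \<le> 1 / real P"
    proof -
      have "4 * P \<le> 2 ^ P" using P by (induction P rule: nat_induct_at_least) simp_all
      then have "real (4 * P) \<le> real (2 ^ P)" by (simp only: of_nat_le_iff)
      then show ?thesis using P by (simp add: power_divide field_simps)
    qed
    finally show ?thesis .
  qed
  have ypos: "0 \<le> y k" for k by (induction k) (simp_all add: y)
  have bound: "y k \<le> t ^ k * (1 + k * X)" for k
  proof (induction k)
    case (Suc k)
    have "y (Suc k) = y k + (2 ^ P * (4 * (5 / 4) ^ (3 * P)) + 2 ^ P * (4 * (5 / 8) ^ (3 * P)) * y k)"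
      by (simp only: y(2) distrib_left mult.assoc)
    also have "\<dots> \<le> y k + (X + 1 / real P * y k)"
      by (intro add_mono mult_right_mono order_refl X T ypos)
    also have "\<dots> = t * y k + X" by (simp add: t_def distrib_right)
    also have "\<dots> \<le> t * (t ^ k * (1 + k * X)) + t ^ Suc k * X"
    proof (rule add_mono)
      show "t * y k \<le> t * (t ^ k * (1 + k * X))" using Suc t1 by (intro mult_left_mono) simp_all
      have "1 * X \<le> t ^ Suc k * X"
        by (intro mult_right_mono one_le_power t1) (simp add: X_def)
      then show "X \<le> t ^ Suc k * X" by simp
    qed
    also have "\<dots> = t ^ Suc k * (1 + Suc k * X)" by (simp add: algebra_simps)
    finally show ?case .
  qed (simp add: y)
  have "t ^ P \<le> exp (1 / real P) ^ P"
    unfolding t_def by (intro power_mono exp_ge_add_one_self) simp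
  also have "\<dots> = exp 1" using P by (simp add: exp_of_nat_mult[symmetric])
  also have "\<dots> \<le> 3" by (rule exp_le)
  finally have "y P \<le> 3 * (1 + P * X)"
    using bound[of P] mult_right_mono[of "t ^ P" 3 "1 + P * X"] by (simp add: X_def)
  also have "\<dots> = 3 + 12 * real P * 4 ^ P" by (simp add: X_def)
  also have "\<dots> \<le> 13 * real P * 4 ^ P"
  proof -
    have "3 * 1 \<le> real P * 4 ^ P" using P by (intro mult_mono one_le_power) simp_all
    then show ?thesis by simp
  qed
  also have "\<dots> \<le> 2 ^ (P div 2 + 1) * 4 ^ P"
  proof (rule mult_right_mono)
    have "real (13 * P) \<le> real (2 ^ (P div 2 + 1))"
      using last_phase_growth[OF P] by (simp only: of_nat_le_iff)
    then show "13 * real P \<le> 2 ^ (P div 2 + 1)" by simp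
  qed simp
  also have "\<dots> = 2 ^ (2 * P + P div 2 + 1)"
    by (simp add: power_add power_mult)
  finally show ?thesis .
qed

text \<open>A linear yield against an exponential potential, with crossover at \<open>a\<close>:
  where the potential averages at most \<open>2 ^ a\<close>, the second term averages at most
  1.\<close>

lemma self_le_power_shift: "real h \<le> real a + 2 ^ h / 2 ^ a"
proof (cases "h \<le> a")
  case True
  then show ?thesis by (simp add: add_increasing2)
next
  case False
  then have "(2::real) ^ h / 2 ^ a = 2 ^ (h - a)" by (simp add: power_diff)
  moreover have "real (h - a) \<le> 2 ^ (h - a)"
    using less_exp[of "h - a"] by (metis less_imp_le of_nat_le_iff of_nat_numeral of_nat_power)
  ultimately show ?thesis using False by simp
qed

lemma one_plus_power_le:
  fixes q h :: nat
  assumes "0 < q" "10 * h \<le> q"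
  shows "(1 + 1 / real q) ^ h - 1 \<le> 11 / 10 * (h / q)"
proof -
  define u where "u = real h / q"
  have u: "0 \<le> u" "u \<le> 1 / 10" using assms by (simp_all add: u_def field_simps)
  have "(1 + 1 / real q) ^ h \<le> exp (1 / real q) ^ h" by (intro power_mono exp_ge_add_one_self) simp
  also have "\<dots> = exp u" by (simp add: exp_of_nat_mult[symmetric] u_def)
  also have "\<dots> \<le> 1 + u + u\<^sup>2" using exp_bound[of u] u by simp
  also have "u\<^sup>2 \<le> 1 / 10 * u" unfolding power2_eq_square using u by (intro mult_right_mono)
  finally show ?thesis by (simp add: u_def)
qed

subsection \<open>The three ranges of parameters\<close>

context preemptive_family
begin

text \<open>On the degenerate input a profit of at most 1 must reach \<open>opt I / c\<close>, so
  \<open>opt I \<le> c\<close> and \<open>n \<le> c * (2 ^ b + 1)\<close>; the lower bound on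
  \<open>n\<close> then yields \<open>4 * c - 3 \<le> 2 ^ b\<close>.\<close>

lemma few_requests_bound:
  fixes c :: real
  assumes card: "card F = 2 ^ b" and c: "8 \<le> c" and n: "4 * c\<^sup>2 - 2 * c \<le> n"
    and comp: "\<And>I. valid_input I \<Longrightarrow> length I \<le> n \<Longrightarrow> \<exists>\<phi>\<in>F. opt I / c \<le> card (K \<phi> I)"
  shows "log 2 (2 * c) \<le> b"
proof -
  obtain I where I: "valid_input I" "length I = n" "n \<le> opt I * Suc (card F)"
    "\<forall>\<phi>\<in>F. card (K \<phi> I) \<le> 1" using opt_of_weak_input by blast
  obtain \<phi> where "\<phi> \<in> F" "opt I / c \<le> card (K \<phi> I)" using comp[OF I(1)] I(2) by auto
  moreover from this I(4) have "real (card (K \<phi> I)) \<le> 1" by simp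
  ultimately have "opt I / c \<le> 1" by linarith
  then have opt: "opt I \<le> c" using c by (simp add: field_simps)
  have "c * (4 * c - 2) \<le> n" using n by (simp add: power2_eq_square algebra_simps)
  also have "real n \<le> real (opt I * Suc (card F))" using I(3) by (simp only: of_nat_le_iff)
  also have "\<dots> = real (opt I) * (2 ^ b + 1)" by (simp add: card algebra_simps)
  also have "\<dots> \<le> c * (2 ^ b + 1)" by (intro mult_right_mono opt) simp
  finally have "4 * c - 2 \<le> 2 ^ b + 1" using c by simp
  then have "2 * c \<le> 2 ^ b" using c by linarith
  then have "log 2 (2 * c) \<le> log 2 (2 ^ b)" using c by (intro log_mono) simp_all
  then show ?thesis by simp
qed

text \<open>Blocks of a single clique of \<open>s\<close> vertices; \<open>s \<approx> 5 * c\<close> and base \<open>5\<close> nearly maximize the bound.\<close>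

lemma small_ratio_bound:
  fixes c :: real
  assumes card: "card F = 2 ^ b" and c: "8 \<le> c" and n: "200 * c\<^sup>2 \<le> n"
    and L: "log 2 (2 * c) \<le> 39"
    and comp: "\<And>I. valid_input I \<Longrightarrow> length I \<le> n \<Longrightarrow> \<exists>\<phi>\<in>F. opt I / c \<le> card (K \<phi> I)"
  shows "log 2 (2 * c) / 200 * (n / c\<^sup>2) \<le> b"
proof -
  define s where "s = nat \<lceil>5 * c\<rceil>"
  \<comment> \<open>Rounding up costs less than \<open>1 \<le> c / 8\<close>.\<close>
  have s: "5 * c \<le> s" "s \<le> 41 / 8 * c" using c by (simp_all add: s_def) linarith
  then have s0: "0 < s" using c by linarith
  define m where "m = n div s"
  \<comment> \<open>A block is one clique, so \<open>h \<le> 1\<close> and \<open>e2 = 0\<close>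
    suffices.\<close>
  have gain: "((1 + (5 - 1) / real s) ^ h - 1) / real (1 ^ 0) \<le> 4 / real s + 0 * 5 ^ h"
    if "h \<le> Suc 0 * 1" for h
    using that by (cases h) simp_all
  obtain I C where I: "valid_input I" "length I = m * (Suc 0 * 1 * s)"
    and C: "C \<subseteq> {..<length I}" "\<forall>u\<in>C. \<forall>v\<in>C. u \<notin> I ! v" "m * (Suc 0 * 1) \<le> card C"
    and good: "(\<Sum>\<phi>\<in>F. 5 ^ card (K \<phi> I \<inter> C)) \<le> card F * (1 + (4 / real s + 0 * 6)) ^ m"
    and bad: "\<forall>\<phi>. card (K \<phi> I - C) \<le> Suc 0 * 1"
  proof -
    have "\<exists>I C. valid_input I \<and> length I = m * (Suc 0 * 1 * s) \<and> C \<subseteq> {..<length I} \<and>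
      (\<forall>u\<in>C. \<forall>v\<in>C. u \<notin> I ! v) \<and> m * (Suc 0 * 1) \<le> card C \<and>
      (\<Sum>\<phi>\<in>F. 5 ^ card (K \<phi> I \<inter> C)) \<le> card F * (1 + (4 / real s + 0 * 6)) ^ m \<and>
      (\<Sum>\<phi>\<in>F. 5 ^ card (K \<phi> I)) \<le> card F * (1 + 6 * (\<Sum>i<m. (1 + (4 / real s + 0 * 6)) ^ i)) \<and>
      (\<forall>\<phi>. card (K \<phi> I - C) \<le> Suc 0 * 1)"
      \<comment> \<open>\<open>D = 1\<close> means no splits: \<open>AB\<close> becomes an identity
        and the recursion reads \<open>y (Suc k) = 6 * y k\<close>.\<close>
      by (rule play_blocks[where D = 1 and q = s and A = 0 and B = 1 and y = "\<lambda>k. 6 ^ k"])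
        (use s0 gain in simp_all)
    then show ?thesis using that by blast
  qed
  have "m * s \<le> n" by (simp add: m_def)
  then obtain \<phi> where \<phi>: "\<phi> \<in> F" "opt I / c \<le> card (K \<phi> I)"
    using comp[OF I(1)] I(2) by auto
  have "m \<le> opt I"
    using C card_le_opt[of I C] by (simp add: independent_set_iff[OF I(1)])
  then have "m / c \<le> opt I / c" using c by (intro divide_right_mono) simp_all
  also note \<phi>(2)
  also have "card (K \<phi> I) \<le> card (K \<phi> I \<inter> C) + card (K \<phi> I - C)"
    using card_Un_le[of "K \<phi> I \<inter> C" "K \<phi> I - C"] by (simp add: Int_Diff_Un)
  also have "\<dots> \<le> card (K \<phi> I \<inter> C) + 1" using bad by simp
  \<comment> \<open>At most one held vertex is bad, so the good ones nearly meet the competitive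
    demand alone.\<close>
  finally have k: "m / c - 1 \<le> card (K \<phi> I \<inter> C)" by simp
  have "(5::real) ^ card (K \<phi> I \<inter> C) \<le> (\<Sum>\<phi>\<in>F. 5 ^ card (K \<phi> I \<inter> C))"
    by (rule member_power_le_sum[OF finite_F \<phi>(1)]) simp
  also have "\<dots> \<le> 2 ^ b * (1 + 4 / s) ^ m" using good card by simp
  finally have "(5::real) ^ card (K \<phi> I \<inter> C) \<le> 2 ^ b * (1 + 4 / s) ^ m" .
  moreover have pos: "0 < 1 + 4 / real s" by (simp add: add_pos_nonneg)
  ultimately have "log 2 (5 ^ card (K \<phi> I \<inter> C)) \<le> log 2 (2 ^ b * (1 + 4 / s) ^ m)"
    by (intro log_mono) simp_all
  also have "\<dots> = b + m * log 2 (1 + 4 / s)"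
    using pos by (simp add: log_mult_pos log_nat_power)
  also have "\<dots> \<le> b + m * (6 / s)"
    using log2_add_one_le[of "4 / s"] by (intro add_left_mono mult_left_mono) simp_all
  also have "\<dots> \<le> b + m * (6 / (5 * c))"
    using s c by (intro add_left_mono mult_left_mono divide_left_mono) simp_all
  finally have "card (K \<phi> I \<inter> C) * log 2 5 \<le> b + m * (6 / (5 * c))"
    by (simp add: log_nat_power)
  moreover have "card (K \<phi> I \<inter> C) * (23 / 10) \<le> card (K \<phi> I \<inter> C) * log 2 5"
    by (intro mult_left_mono log2_5_ge) simp
  ultimately have "(m / c - 1) * (23 / 10) \<le> b + m * (6 / (5 * c))"
    using mult_right_mono[OF k, of "23 / 10"] by linarith
  moreover have "m * (6 / (5 * c)) = 6 / 5 * (m / c)" by simp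
  ultimately have b: "11 / 10 * (m / c) - 23 / 10 \<le> b" by argo
  have "n < (m + 1) * s" unfolding m_def using s0 by (simp add: dividend_less_div_times)
  then have "real n < real ((m + 1) * s)" by (simp only: of_nat_less_iff)
  also have "\<dots> = real (m + 1) * real s" by (rule of_nat_mult)
  also have "\<dots> \<le> real (m + 1) * (41 / 8 * c)" by (intro mult_left_mono s) simp
  finally have "n / c\<^sup>2 \<le> (m + 1) * (41 / 8) / c"
    using c by (simp add: field_simps power2_eq_square)
  then have "n / c\<^sup>2 \<le> 41 / 8 * (m / c) + 41 / 8 * (1 / c)"
    by (simp add: add_divide_distrib algebra_simps)
  then have N: "8 / 41 * (n / c\<^sup>2) - 1 / c \<le> m / c" by linarith
  have "1 / c \<le> 1 / 8" using c by (simp add: field_simps)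
  have "11 / 10 * (8 / 41 * X - 1 / 8) - 23 / 10 \<le> b"
    if "8 / 41 * X - z \<le> M" "11 / 10 * M - 23 / 10 \<le> b" "z \<le> 1 / 8" for X M z :: real
    using that by argo
  from this[OF N b \<open>1 / c \<le> 1 / 8\<close>]
  have "11 / 10 * (8 / 41 * (n / c\<^sup>2) - 1 / 8) - 23 / 10 \<le> b" .
  moreover have "200 \<le> n / c\<^sup>2" using n c by (simp add: field_simps)
  moreover have "log 2 (2 * c) / 200 * (n / c\<^sup>2) \<le> 39 / 200 * (n / c\<^sup>2)"
    using L by (intro mult_right_mono) simp_all
  \<comment> \<open>The slope \<open>11 / 10 * 8 / 41\<close> exceeds \<open>39 / 200\<close>, and
    for \<open>n / c ^ 2 \<ge> 200\<close> the excess outweighs the constant loss.\<close>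
  ultimately show ?thesis by argo
qed

text \<open>\<open>P\<close> phases of \<open>P\<close> layers with \<open>P \<approx> L / 3\<close>, each class splitting into \<open>D = 4\<close>, base \<open>2\<close>.
  The number \<open>4 ^ p < (2 * c) powr (2 / 3)\<close> of classes is small compared to \<open>s \<approx> 9 * c / P\<close>, and a
  strategy holds about \<open>a \<approx> 5 / 2 * P\<close> of the \<open>P * P\<close> layers of a block.\<close>

lemma large_ratio_bound:
  fixes c :: real
  assumes card: "card F = 2 ^ b" and c: "8 \<le> c" and n: "200 * c\<^sup>2 \<le> n"
    and L: "39 < log 2 (2 * c)"
    and comp: "\<And>I. valid_input I \<Longrightarrow> length I \<le> n \<Longrightarrow> \<exists>\<phi>\<in>F. opt I / c \<le> card (K \<phi> I)"
  shows "log 2 (2 * c) / 200 * (n / c\<^sup>2) \<le> b"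
proof -
  define L where "L = log 2 (2 * c)"
  define P where "P = nat \<lceil>L / 3\<rceil>"
  have P: "L / 3 \<le> P" "P < L / 3 + 1" "14 \<le> P"
    using L unfolding P_def L_def by linarith+
  define p where "p = P - 1"
  have p: "Suc p = P" using P(3) by (simp add: p_def)
  \<comment> \<open>Rests on \<open>3 * p < L\<close>, which is why \<open>p\<close> is one less
    than the rounded \<open>L / 3\<close>.\<close>
  have "8 ^ p = (2::real) ^ (3 * p)" by (simp add: power_mult)
  also have "\<dots> = 2 powr real (3 * p)" by (rule powr_realpow[symmetric]) simp
  also have "\<dots> < 2 powr L" using P(2) p by (intro powr_less_mono) linarith+
  also have "\<dots> = 2 * c" using c by (simp add: L_def)
  finally have c8: "8 ^ p < 2 * c" .
  have cube: "40 * real P ^ 3 \<le> 17 * 2 ^ p"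
  proof -
    have "real (40 * P ^ 3) \<le> real (17 * 2 ^ (P - 1))"
      using cube_le_power[OF P(3)] by (simp only: of_nat_le_iff)
    then show ?thesis by (simp add: p_def)
  qed
  have P0: "0 < real P" using P(3) by simp
  have cube4: "real P ^ 3 * 4 ^ p \<le> 17 / 20 * c"
  proof -
    have "40 * real P ^ 3 * 4 ^ p \<le> 17 * 2 ^ p * 4 ^ p" by (intro mult_right_mono cube) simp
    also have "\<dots> = 17 * 8 ^ p" by (simp add: power_mult_distrib[symmetric])
    finally show ?thesis using c8 by simp
  qed
  have P2: "196 * real P \<le> real P ^ 3"
  proof -
    have "14 * 14 * real P \<le> real P * real P * real P" using P(3) by (intro mult_mono) simp_all
    then show ?thesis by (simp add: power3_eq_cube)
  qed
  \<comment> \<open>Chosen so that \<open>s * P\<close> lies between \<open>9 * c\<close> and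
    \<open>19 / 2 * c\<close>.\<close>
  define q where "q = nat \<lceil>9 * c / (real P * 4 ^ p)\<rceil>"
  have q: "9 * c / (real P * 4 ^ p) \<le> q" "q \<le> 9 * c / (real P * 4 ^ p) + 1"
    using c by (simp_all add: q_def)
  define s where "s = 4 ^ p * q"
  have s_real: "real s = 4 ^ p * real q" by (simp add: s_def)
  have sP: "9 * c \<le> real s * real P"
    using q(1) P0 by (simp add: s_real field_simps)
  have "real s * real P \<le> 9 * c + real P * 4 ^ p"
    using q(2) P0 by (simp add: s_real field_simps)
  also have "real P * 4 ^ p \<le> 1 / 2 * c"
  proof -
    have "196 * (real P * 4 ^ p) \<le> real P ^ 3 * 4 ^ p"
      using mult_right_mono[OF P2, of "4 ^ p"] by simp
    then show ?thesis using cube4 c by linarith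
  qed
  finally have sP': "real s * real P \<le> 19 / 2 * c" by simp
  \<comment> \<open>Lets \<open>one_plus_power_le\<close> apply to every \<open>h\<close> up to the
    \<open>P * P\<close> layers of a block.\<close>
  have q10: "10 * (P * P) \<le> q"
  proof -
    have "10 * real (P * P) * (real P * 4 ^ p) \<le> 9 * c"
      using cube4 c by (simp add: power3_eq_cube mult.assoc)
    then have "10 * real (P * P) \<le> 9 * c / (real P * 4 ^ p)" using P0 by (simp add: field_simps)
    then have "real (10 * (P * P)) \<le> real q" using q(1) by simp
    then show ?thesis by (simp only: of_nat_le_iff)
  qed
  have q0: "0 < q" using q10 P(3) by (intro gr0I) simp
  then have s0: "0 < s" by (simp add: s_def)
  \<comment> \<open>The exponent supplied by \<open>phase_recursion_bound\<close>.\<close>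
  define a where "a = 2 * P + P div 2 + 1"
  have a: "a \<le> 5 / 2 * P + 1" "2 * P \<le> a"
  proof -
    have "2 * (P div 2) \<le> P" by simp
    then have "real (2 * (P div 2)) \<le> P" by (simp only: of_nat_le_iff)
    then show "a \<le> 5 / 2 * P + 1" by (simp add: a_def)
  qed (simp add: a_def)
  define y :: "nat \<Rightarrow> real" where "y k = rec_nat 1
    (\<lambda>_ z. z + 2 ^ P * (4 * (5 / 4) ^ (3 * P) + 4 * (5 / 8) ^ (3 * P) * z)) k" for k
  have y: "y 0 = (1::real)"
    "\<And>k. y (Suc k) = y k + 2 ^ P * (4 * (5 / 4) ^ (3 * P) + 4 * (5 / 8) ^ (3 * P) * y k)"
    by (simp_all add: y_def)
  have yP: "y (Suc p) \<le> 2 ^ a"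
    unfolding p a_def by (rule phase_recursion_bound[OF P(3) y])
  \<comment> \<open>The yield \<open>11 / 10 * h / s\<close> of a block, linearized by
    \<open>self_le_power_shift\<close> with crossover \<open>a\<close>; at potential
    \<open>2 ^ a\<close> the two terms add up to \<open>\<eta>\<close>.\<close>
  define e1 where "e1 = 11 / 10 * a / real s"
  define e2 where "e2 = 11 / 10 / (s * 2 ^ a)"
  have e: "0 \<le> e1" "0 \<le> e2" by (simp_all add: e1_def e2_def)
  have gain: "((1 + (2 - 1) / real q) ^ h - 1) / real (4 ^ p) \<le> e1 + e2 * 2 ^ h"
    if "h \<le> Suc p * P" for h
  proof -
    have "10 * h \<le> q" using that q10 unfolding p by linarith
    then have "((1 + 1 / real q) ^ h - 1) / 4 ^ p \<le> 11 / 10 * (h / q) / 4 ^ p"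
      by (intro divide_right_mono one_plus_power_le q0) simp_all
    also have "\<dots> = 11 / 10 * real h / s" by (simp add: s_real field_simps)
    also have "\<dots> \<le> 11 / 10 * (a + 2 ^ h / 2 ^ a) / s"
      by (intro divide_right_mono mult_left_mono self_le_power_shift) simp_all
    also have "\<dots> = e1 + e2 * 2 ^ h"
      by (simp add: e1_def e2_def add_divide_distrib distrib_left)
    finally show ?thesis by simp
  qed
  have AB: "real 4 * (1 + (2 - 1) / real 4) ^ h \<le> 4 * (5 / 4) ^ (3 * P) + 4 * (5 / 8) ^ (3 * P) * 2 ^ h"
    for h using five_quarters_power_le[of h P] by simp
  define \<eta> where "\<eta> = 11 / 10 * (a + 1) / real s"
  have \<eta>: "e1 + e2 * 2 ^ a = \<eta>"
    by (simp add: e1_def e2_def \<eta>_def add_divide_distrib distrib_left)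
  have \<eta>0: "0 < \<eta>" using s0 by (simp add: \<eta>_def)
  define m where "m = n div (P * P * s)"
  have "\<exists>I C. valid_input I \<and> length I = m * (Suc p * P * s) \<and> C \<subseteq> {..<length I} \<and>
      (\<forall>u\<in>C. \<forall>v\<in>C. u \<notin> I ! v) \<and> m * (Suc p * P) \<le> card C \<and>
      (\<Sum>\<phi>\<in>F. 2 ^ card (K \<phi> I \<inter> C)) \<le> card F * (1 + (e1 + e2 * 2 ^ a)) ^ m \<and>
      (\<Sum>\<phi>\<in>F. 2 ^ card (K \<phi> I)) \<le> card F * (1 + 2 ^ a * (\<Sum>i<m. (1 + (e1 + e2 * 2 ^ a)) ^ i)) \<and>
      (\<forall>\<phi>. card (K \<phi> I - C) \<le> Suc p * P)"
    by (rule play_blocks[where D = 4 and q = q and y = y, OF _ q0 _ _ _ AB y yP _ e gain])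
      (simp_all add: s_def)
  then obtain I C where I: "valid_input I" "length I = m * (P * P * s)"
    and C: "C \<subseteq> {..<length I}" "\<forall>u\<in>C. \<forall>v\<in>C. u \<notin> I ! v" "m * (P * P) \<le> card C"
    and all: "(\<Sum>\<phi>\<in>F. 2 ^ card (K \<phi> I)) \<le> card F * (1 + 2 ^ a * (\<Sum>i<m. (1 + \<eta>) ^ i))"
    unfolding p \<eta> by blast
  have "m * (P * P * s) \<le> n" unfolding m_def by (rule div_times_less_eq_dividend)
  then obtain \<phi> where \<phi>: "\<phi> \<in> F" "opt I / c \<le> card (K \<phi> I)"
    using comp[OF I(1)] I(2) by auto
  have "m * (P * P) \<le> opt I"
    using C card_le_opt[of I C] by (simp add: independent_set_iff[OF I(1)])
  then have "real (m * (P * P)) / c \<le> opt I / c"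
    using c by (intro divide_right_mono of_nat_mono) simp_all
  then have k: "m * ((real P)\<^sup>2 / c) \<le> card (K \<phi> I)"
    using \<phi>(2) by (simp add: power2_eq_square)
  have \<eta>1: "\<eta> \<le> 1"
  proof -
    have "11 / 10 * (real a + 1) * P \<le> 9 * c"
    proof -
      have "11 / 10 * (real a + 1) \<le> 4 * real P" using a(1) P(3) by simp
      then have "11 / 10 * (real a + 1) * real P \<le> 4 * real P * real P" by (rule mult_right_mono) simp
      also have "\<dots> \<le> real P * real P * real P"
        using P(3) mult_right_mono[of 4 "real P" "real P * real P"] by (simp add: mult.assoc)
      also have "\<dots> = real P ^ 3 * 1" by (simp add: power3_eq_cube)
      also have "\<dots> \<le> real P ^ 3 * 4 ^ p" by (intro mult_left_mono one_le_power) simp_all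
      finally show ?thesis using cube4 c by linarith
    qed
    then have "11 / 10 * (real a + 1) * P \<le> real s * real P" using sP by linarith
    then have "11 / 10 * (real a + 1) \<le> s" using P0 by (simp add: mult_le_cancel_right)
    then show ?thesis using s0 by (simp add: \<eta>_def)
  qed
  \<comment> \<open>Here the potential of all held vertices is used: subtracting up to
    \<open>P * P\<close> bad ones would cost a term quadratic in \<open>L\<close>.\<close>
  have "(2::real) ^ card (K \<phi> I) \<le> (\<Sum>\<phi>\<in>F. 2 ^ card (K \<phi> I))"
    by (rule member_power_le_sum[OF finite_F \<phi>(1)]) simp
  also have "\<dots> \<le> 2 ^ b * (1 + 2 ^ a * (((1 + \<eta>) ^ m - 1) / \<eta>))"
    using all \<eta>0 unfolding card by (simp add: geometric_sum)
  also have "\<dots> \<le> 2 ^ b * (2 ^ a * (1 + \<eta>) ^ m / \<eta>)"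
  proof (rule mult_left_mono)
    have "\<eta> \<le> 2 ^ a" using \<eta>1 by (rule order_trans) simp
    then show "1 + 2 ^ a * (((1 + \<eta>) ^ m - 1) / \<eta>) \<le> 2 ^ a * (1 + \<eta>) ^ m / \<eta>"
      using \<eta>0 by (simp add: field_simps)
  qed simp
  finally have "log 2 (2 ^ card (K \<phi> I)) \<le> log 2 (2 ^ b * (2 ^ a * (1 + \<eta>) ^ m / \<eta>))"
    by (intro log_mono) simp_all
  then have k': "card (K \<phi> I) \<le> real b + real a + m * log 2 (1 + \<eta>) - log 2 \<eta>"
    using \<eta>0 by (simp add: log_mult_pos log_divide_pos log_nat_power)
  \<comment> \<open>Guessing earns at most half of the \<open>P ^ 2 / c\<close> vertices demanded
    per block.\<close>
  have growth: "m * log 2 (1 + \<eta>) \<le> m * ((real P)\<^sup>2 / (2 * c))"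
  proof (rule mult_left_mono)
    have "33 / 20 * (real a + 1) \<le> 33 / 20 * (53 / 20 * P)" using a(1) P(3) by simp
    also have "\<dots> \<le> 9 / 2 * P" using P0 by simp
    finally have "33 / 20 * (real a + 1) / s \<le> 9 / 2 * P / s" by (rule divide_right_mono) simp
    also have "\<dots> = 9 / 2 * (real P)\<^sup>2 / (real s * real P)" using P0 by (simp add: power2_eq_square)
    also have "\<dots> \<le> 9 / 2 * (real P)\<^sup>2 / (9 * c)" using sP c by (intro divide_left_mono) simp_all
    finally have "33 / 20 * (real a + 1) / s \<le> (real P)\<^sup>2 / (2 * c)" by simp
    moreover have "33 / 20 * (real a + 1) / s = 3 / 2 * \<eta>" by (simp add: \<eta>_def add.commute)
    ultimately show "log 2 (1 + \<eta>) \<le> (real P)\<^sup>2 / (2 * c)"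
      using log2_add_one_le[of \<eta>] \<eta>0 by linarith
  qed simp
  \<comment> \<open>\<open>L - 1\<close> is \<open>log 2 c\<close>, so the claim amounts to
    \<open>1 / c \<le> \<eta>\<close>.\<close>
  have log\<eta>: "- log 2 \<eta> \<le> L - 1"
  proof -
    have "real s * 1 \<le> real s * real P" using P(3) by (intro mult_left_mono) simp_all
    then have "s \<le> 19 / 2 * c" using sP' by linarith
    also have "\<dots> \<le> 11 / 10 * (a + 1) * c"
      using a(2) P(3) c by (intro mult_right_mono) simp_all
    finally have "1 / c \<le> \<eta>" using s0 c by (simp add: \<eta>_def field_simps)
    then have "log 2 (1 / c) \<le> log 2 \<eta>" using c by (intro log_mono) simp_all
    moreover have "log 2 (1 / c) = - log 2 c" using c by (simp add: log_divide_pos)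
    moreover have "L = 1 + log 2 c" using c by (simp add: L_def log_mult_pos)
    ultimately show ?thesis by linarith
  qed
  \<comment> \<open>The other half of the demand must be paid by advice, up to a loss linear in
    \<open>L\<close>.\<close>
  have b: "m * ((real P)\<^sup>2 / (2 * c)) \<le> b + (5 / 2 * P + 1) + (L - 1)"
  proof -
    have "m * ((real P)\<^sup>2 / c) = m * ((real P)\<^sup>2 / (2 * c)) + m * ((real P)\<^sup>2 / (2 * c))"
      using c by (simp add: field_simps)
    then show ?thesis using k k' growth log\<eta> a(1) by argo
  qed
  have "0 < P * P * s" using s0 P(3) by simp
  then have "n < P * P * s * m + P * P * s"
    unfolding m_def using dividend_less_times_div[of "P * P * s" n] by (simp only: add.commute)
  then have "real n < real (P * P * s * m + P * P * s)" by (simp only: of_nat_less_iff)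
  also have "\<dots> = real (m + 1) * (real s * real P * real P)" by (simp add: algebra_simps)
  also have "\<dots> \<le> real (m + 1) * (19 / 2 * c * real P)"
    using sP' by (intro mult_left_mono mult_right_mono) simp_all
  finally have n_le: "n \<le> (m + 1) * (19 / 2 * c * P)" by simp
  \<comment> \<open>The factor \<open>P / 19\<close> is what turns
    \<open>19 / 2 * c * P / c ^ 2\<close> into the half demand
    \<open>P ^ 2 / (2 * c)\<close>.\<close>
  have "n / c\<^sup>2 * (P / 19) \<le> (m + 1) * (19 / 2 * c * P) / c\<^sup>2 * (P / 19)"
    by (intro mult_right_mono divide_right_mono n_le) simp_all
  also have "\<dots> = m * ((real P)\<^sup>2 / (2 * c)) + (real P)\<^sup>2 / (2 * c)"
    using c by (simp add: field_simps power2_eq_square)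
  finally have N0: "n / c\<^sup>2 * (P / 19) \<le> m * ((real P)\<^sup>2 / (2 * c)) + (real P)\<^sup>2 / (2 * c)" .
  have "(real P)\<^sup>2 / (2 * c) \<le> 1"
  proof -
    have "real P ^ 2 * 1 \<le> real P ^ 3" using P(3) by (simp add: power2_eq_square power3_eq_cube)
    also have "\<dots> = real P ^ 3 * 1" by simp
    also have "\<dots> \<le> real P ^ 3 * 4 ^ p" by (intro mult_left_mono one_le_power) simp_all
    finally show ?thesis using cube4 c by simp
  qed
  with N0 have N: "n / c\<^sup>2 * (P / 19) \<le> m * ((real P)\<^sup>2 / (2 * c)) + 1" by argo
  have n200: "200 \<le> n / c\<^sup>2" using n c by (simp add: field_simps)
  have L39: "39 < L" using L by (simp add: L_def)
  have "L / 3 * (n / c\<^sup>2 / 19 - 5 / 2) \<le> P * (n / c\<^sup>2 / 19 - 5 / 2)"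
    using P(1) n200 by (intro mult_right_mono) simp_all
  then have 1: "L * (n / c\<^sup>2) / 57 - 5 / 6 * L \<le> n / c\<^sup>2 * (P / 19) - 5 / 2 * P"
    by (simp add: algebra_simps)
  \<comment> \<open>Since \<open>n / c ^ 2 \<ge> 200\<close>, replacing the slope
    \<open>1 / 57\<close> by \<open>1 / 200\<close> frees more than \<open>5 / 2 * L\<close>, which
    covers the loss \<open>11 / 6 * L + 1\<close>.\<close>
  have "L * 200 \<le> L * (n / c\<^sup>2)" using n200 L39 by (intro mult_left_mono) simp_all
  then have "L * (n / c\<^sup>2) / 200 \<le> b" using 1 N b L39 by argo
  then show ?thesis by (simp add: L_def)
qed

end

section \<open>From an algorithm with advice to a finite family of strategies, and the choice of the
  range\<close>

theorem theorem16:
  fixes A :: algorithm and c :: "nat \<Rightarrow> real" and b :: "nat \<Rightarrow> nat" and n :: nat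
  assumes "mis_preemption_algorithm A"
    and "competitive_with_advice A c b"
    and "8 \<le> c n"
    and "c n \<le> (1 + sqrt (1 + 4 * real n)) / 4"
  shows "real (b n) \<ge> 0.01 * log 2 (2 * c n) / (2 * (c n)\<^sup>2) * (real n - 2 * c n)"
proof -
  \<comment> \<open>The advice strings that are false from position \<open>b n\<close> on.\<close>
  define F :: "advice set" where "F = (\<lambda>X k. k \<in> X) ` Pow {..<b n}"
  define K where "K \<phi> I = kept A \<phi> I (length I)" for \<phi> I
  have "inj_on (\<lambda>(X :: nat set) k. k \<in> X) (Pow {..<b n})"
    by (rule inj_onI) (simp add: fun_eq_iff set_eq_iff)
  then have card: "card F = 2 ^ b n" by (simp add: F_def card_image card_Pow)
  have indep: "independent_set I (K \<phi> I)" if "valid_input I" for \<phi> I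
    using assms(1) that unfolding mis_preemption_algorithm_def K_def by blast
  interpret preemptive_family F K
  proof
    show "finite F" by (simp add: F_def)
    show "K \<phi> I \<subseteq> {..<length I}" if "valid_input I" for \<phi> I
      using indep[OF that, of \<phi>] by (simp add: independent_set_iff[OF that])
    show "u \<notin> I ! v" if "valid_input I" "u \<in> K \<phi> I" "v \<in> K \<phi> I" for I \<phi> u v
      using indep[OF that(1), of \<phi>] that(2,3) by (simp add: independent_set_iff[OF that(1)])
    show "K \<phi> (I @ J) \<inter> {..<length I} \<subseteq> K \<phi> I" for \<phi> I J
      using kept_anti_mono[of "length I" "length (I @ J)" A \<phi> "I @ J"] kept_append[of "length I" I A \<phi> J]
      by (simp add: K_def)
  qed
  have comp: "\<exists>\<phi>\<in>F. opt I / c n \<le> card (K \<phi> I)" if I: "valid_input I" "length I \<le> n" for I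
  proof -
    obtain \<phi> where \<phi>: "1 / c n * opt I \<le> profit A \<phi> I" "reads_at_most A \<phi> I (b n)"
      using assms(2) I unfolding competitive_with_advice_def by blast
    \<comment> \<open>Truncating \<open>\<phi>\<close> after \<open>b n\<close> bits changes no
      decision on \<open>I\<close>, by \<open>reads_at_most\<close>.\<close>
    define X where "X = {k. k < b n \<and> \<phi> k}"
    define \<psi> :: advice where "\<psi> = (\<lambda>k. k \<in> X)"
    have "X \<in> Pow {..<b n}" by (auto simp: X_def)
    then have "\<psi> \<in> F" unfolding F_def \<psi>_def by (rule imageI)
    moreover have "\<forall>k<b n. \<psi> k = \<phi> k" by (simp add: \<psi>_def X_def)
    then have "A \<psi> (take (Suc i) I) = A \<phi> (take (Suc i) I)" if "i < length I" for i
      using \<phi>(2) that unfolding reads_at_most_def by blast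
    then have "K \<psi> I = K \<phi> I" unfolding K_def by (rule kept_cong) simp_all
    then have "opt I / c n \<le> card (K \<psi> I)" using \<phi>(1) by (simp add: profit_def K_def)
    ultimately show ?thesis by blast
  qed
  let ?L = "log 2 (2 * c n)"
  have c: "8 \<le> c n" by (rule assms(3))
  have L: "0 \<le> ?L" using c by simp
  \<comment> \<open>Solved for \<open>n\<close>, the upper bound on \<open>c n\<close> is the length
    condition of \<open>few_requests_bound\<close>.\<close>
  have "4 * c n - 1 \<le> sqrt (1 + 4 * real n)" using assms(4) by simp
  then have "(4 * c n - 1)\<^sup>2 \<le> 1 + 4 * real n" using c by (intro sqrt_ge_absD) simp
  then have n: "4 * (c n)\<^sup>2 - 2 * c n \<le> n" by (simp add: power2_eq_square algebra_simps)
  \<comment> \<open>The stronger bound without the subtracted \<open>2 * c n\<close> is proved;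
    \<open>1 / 200\<close> is \<open>0.01 / 2\<close>.\<close>
  have "0.01 * ?L / (2 * (c n)\<^sup>2) * (real n - 2 * c n) \<le> 0.01 * ?L / (2 * (c n)\<^sup>2) * n"
    using L c by (intro mult_left_mono) simp_all
  also have "\<dots> = ?L / 200 * (n / (c n)\<^sup>2)" by simp
  also have "\<dots> \<le> b n"
  proof (cases "200 * (c n)\<^sup>2 \<le> n")
    case True
    then show ?thesis
      using small_ratio_bound[OF card c True _ comp] large_ratio_bound[OF card c True _ comp]
      by (cases "?L \<le> 39") simp_all
  next
    case False
    then have "n / (c n)\<^sup>2 \<le> 200" using c by (simp add: field_simps)
    then have "?L / 200 * (n / (c n)\<^sup>2) \<le> ?L / 200 * 200" using L by (intro mult_left_mono) simp_all
    also have "\<dots> \<le> b n" using few_requests_bound[OF card c n comp] by simp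
    finally show ?thesis .
  qed
  finally show ?thesis .
qed

end
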